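(* Let $N\in\mathbb{N}$ and let $F\subseteq\ell_1^N$ be a non-empty finite set. Define $S_F:=\{r\in\mathbb{R} : 0\le r<\mathrm{chg}(F),\ \det FS(r)\neq0\}$, where $FS(r)$ is the coefficient matrix of the Fragment System of $F$ with parameter $r$, and for $r\in S_F$ let $(\alpha_{p,s}(r))_{(p,s)\in F\times\mathrm{Dir}_N}$ be the unique solution of the Fragment System. For $r\in S_F$ with $r>0$, let $$\omega_{\overline{C}_F(r)}=\Big(\sum_{p\in F}\omega_{\overline{C}_p(r)}\Big)-\sum_{p\in F,\ s\in\mathrm{Dir}_N}\alpha_{p,s}(r)\,\omega_{\mathrm{face}_{p,s}(r)},$$ which is the weight measure of $\overline{C}_F(r)$. Let $w=(w_p)_{p\in F}$ be the weighting of $F$. Then: 1. The maps $\alpha_{p,s}\colon S_F\to\mathbb{R}$ are continuous. 2. There exists a real $\rho$ with $0<\rho\le\mathrm{chg}(F)$ such that $[0,\rho)\subseteq S_F$. 3. For every $p\in F$, $\displaystyle\lim_{r\searrow0}\omega_{\overline{C}_F(r)}\big(\overline{C}_p(r)\big)=w_p$. Hence $\displaystyle\lim_{r\searrow0}\mathrm{mag}\big(\overline{C}_F(r)\big)=\mathrm{mag}(F)$.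
   Context: $\mathbb{N}=\{0,1,2,\dots\}$. $\ell_1^N$ is $\mathbb{R}^N$ with the metric $d_1(x,y)=\sum_k|x_k-y_k|$; for a set $A$, $d_1(A,x)=d_1(x,A)=\inf_{a\in A}d_1(a,x)$. $\mathrm{Dir}_N:=\{-1,0,1\}^N\setminus\{0\}^N$. Cubes and faces: for $p\in\ell_1^N$, $r\ge 0$, $\overline{C}_p(r):=\prod_{k=1}^N[p_k-r,p_k+r]$, and $\overline{C}_F(r):=\bigcup_{p\in F}\overline{C}_p(r)$. Put $L_{-1}=R_{-1}=-1$, $L_0=-1$, $R_0=1$, $L_1=R_1=1$. For $s\in\{-1,0,1\}^N$, $\mathrm{face}_{p,s}(r):=\prod_{k=1}^N[p_k+rL_{s_k},p_k+rR_{s_k}]$. Coordinate half-gap: $\mathrm{chg}(F):=\infty$ if $\#F\le 1$, and otherwise $\mathrm{chg}(F):=\frac12\min\big(\{|p_k-q_k| : p,q\in F,\ 1\le k\le N\}\setminus\{0\}\big)$. Fragments: for $q\in F$, $u\in\mathrm{Dir}_N$, the $u$-fragment of $F$ at $q$ is $F^{\sqsubset}_{q,u}:=\{p\in F : \mathrm{sgn}(p_k-q_k)=u_k \text{ for all } k\}$. The dotted $u$-fragment of $F$ at $q$ is $\mathrm{df}(F)_{q,u}:=\{(p,s)\in F\times\mathrm{Dir}_N : \mathrm{sgn}(p_k+g s_k-q_k)=u_k\text{ for all }k\}$, where $g$ is any real number with $0<g<\mathrm{chg}(F)$ (for $q\in F$ the set does not depend on the choice of $g$). Fragment System (for real $r$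 with $0\le r<\mathrm{chg}(F)$): the system of $\#F\cdot(3^N-1)$ linear equations in the unknowns $(x_{p,s})_{(p,s)\in F\times\mathrm{Dir}_N}$, indexed by $(q,u)\in F\times\mathrm{Dir}_N$, $$\sum_{(p,s)\in\mathrm{df}(F)_{q,u}}x_{p,s}\,e^{-d_1(\mathrm{face}_{p,s}(r),\,q+ru)}=\sum_{p\in F^{\sqsubset}_{q,u}}e^{-d_1(\overline{C}_p(r),\,q+ru)}.$$ $FS(r)$ denotes its (square) coefficient matrix. Weight measures and magnitude: a weight measure of a compact $K\subseteq\ell_1^N$ is a finite signed Borel measure $\omega$ on $K$ with $\int_K e^{-d_1(x,a)}\,d\omega(x)=1$ for all $a\in K$; it is unique if it exists and is denoted $\omega_K$; then $\mathrm{mag}(K):=\omega_K(K)$. Measures on subsets of $\ell_1^N$ are extended by zero to $\ell_1^N$. Each cube and each face has a weight measure: for a product of compact intervals $\prod_k[a_k,b_k]$ (with $a_k\le b_k$) it is the product measure of the $\frac12(\delta_{a_k}+\lambda_{[a_k,b_k]}+\delta_{b_k})$, with $\lambda$ Lebesgue measure and $\delta$ Dirac measure. For finite $F\subseteq\ell_1^N$ the similarity matrix $Z_F=(e^{-d_1(p,q)})_{p,q\in F}$ is positive definite; the weighting of $F$ is the unique $w\in\mathbb{R}^F$ with $Z_Fw=(1,\dots,1)^T$, and $\mathrm{mag}(F)=\sum_{p\in F}w_p$. *)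

theory Defs
  imports "HOL-Analysis.Analysis" "Jordan_Normal_Form.Determinant"
begin

text \<open>
  The space \<open>\<ell>\<^sub>1\<^sup>N\<close> is modelled by the functions \<open>nat \<Rightarrow> real\<close> that are extensional on \<open>{..<N}\<close>
  (coordinates are numbered from \<open>0\<close> to \<open>N - 1\<close>). Unlike an index type, this includes \<open>N = 0\<close>.
\<close>

type_synonym point = "nat \<Rightarrow> real"

definition ell1 :: "nat \<Rightarrow> point set" where
  "ell1 N = {..<N} \<rightarrow>\<^sub>E UNIV"

definition d1 :: "nat \<Rightarrow> point \<Rightarrow> point \<Rightarrow> real" where
  "d1 N x y = (\<Sum>k<N. \<bar>x k - y k\<bar>)"

definition d1_set :: "nat \<Rightarrow> point set \<Rightarrow> point \<Rightarrow> real" where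
  "d1_set N A x = (INF a\<in>A. d1 N a x)"

definition Dir :: "nat \<Rightarrow> point set" where
  "Dir N = ({..<N} \<rightarrow>\<^sub>E {-1, 0, 1}) - ({..<N} \<rightarrow>\<^sub>E {0})"

definition shift :: "nat \<Rightarrow> point \<Rightarrow> real \<Rightarrow> point \<Rightarrow> point" where
  "shift N q r u = (\<lambda>k\<in>{..<N}. q k + r * u k)"

definition cube :: "nat \<Rightarrow> point \<Rightarrow> real \<Rightarrow> point set" where
  "cube N p r = (\<Pi>\<^sub>E k\<in>{..<N}. {p k - r..p k + r})"

definition cubes :: "nat \<Rightarrow> point set \<Rightarrow> real \<Rightarrow> point set" where
  "cubes N F r = (\<Union>p\<in>F. cube N p r)"

definition Lside :: "real \<Rightarrow> real" where
  "Lside t = (if t = 1 then 1 else -1)"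

definition Rside :: "real \<Rightarrow> real" where
  "Rside t = (if t = -1 then -1 else 1)"

definition face :: "nat \<Rightarrow> point \<Rightarrow> point \<Rightarrow> real \<Rightarrow> point set" where
  "face N p s r = (\<Pi>\<^sub>E k\<in>{..<N}. {p k + r * Lside (s k)..p k + r * Rside (s k)})"

definition chg :: "nat \<Rightarrow> point set \<Rightarrow> ereal" where
  "chg N F = (if card F \<le> 1 then \<infinity>
     else ereal (1/2 * Min ({\<bar>p k - q k\<bar> | p q k. p \<in> F \<and> q \<in> F \<and> k < N} - {0})))"

definition fragment :: "nat \<Rightarrow> point set \<Rightarrow> point \<Rightarrow> point \<Rightarrow> point set" where
  "fragment N F q u = {p \<in> F. \<forall>k<N. sgn (p k - q k) = u k}"

text \<open>For \<open>q \<in> F\<close> the set does not depend on the choice of \<open>g\<close>.\<close>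

definition dotted_fragment :: "nat \<Rightarrow> point set \<Rightarrow> point \<Rightarrow> point \<Rightarrow> (point \<times> point) set" where
  "dotted_fragment N F q u =
     (let g = (SOME g::real. 0 < g \<and> ereal g < chg N F)
      in {(p, s) \<in> F \<times> Dir N. \<forall>k<N. sgn (p k + g * s k - q k) = u k})"

definition fs_solution ::
    "nat \<Rightarrow> point set \<Rightarrow> real \<Rightarrow> (point \<times> point \<Rightarrow> real) \<Rightarrow> bool" where
  "fs_solution N F r x \<longleftrightarrow> (\<forall>(q, u) \<in> F \<times> Dir N.
     (\<Sum>(p, s) \<in> dotted_fragment N F q u. x (p, s) * exp (- d1_set N (face N p s r) (shift N q r u)))
     = (\<Sum>p \<in> fragment N F q u. exp (- d1_set N (cube N p r) (shift N q r u))))"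

definition fs_coeff ::
    "nat \<Rightarrow> point set \<Rightarrow> real \<Rightarrow> point \<times> point \<Rightarrow> point \<times> point \<Rightarrow> real" where
  "fs_coeff N F r = (\<lambda>(q, u) (p, s).
     if (p, s) \<in> dotted_fragment N F q u
     then exp (- d1_set N (face N p s r) (shift N q r u)) else 0)"

text \<open>
  Rows and columns are both indexed by \<open>F \<times> Dir N\<close>. The matrix type needs numerical indices, so both
  are enumerated by the same bijection \<open>from_nat_into (F \<times> Dir N)\<close>; the determinant does not depend
  on it.
\<close>

definition FS_mat :: "nat \<Rightarrow> point set \<Rightarrow> real \<Rightarrow> real mat" where
  "FS_mat N F r =
     (let n = card (F \<times> Dir N); e = from_nat_into (F \<times> Dir N)
      in mat n n (\<lambda>(i, j). fs_coeff N F r (e i) (e j)))"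

definition S_set :: "nat \<Rightarrow> point set \<Rightarrow> real set" where
  "S_set N F = {r. 0 \<le> r \<and> ereal r < chg N F \<and> Determinant.det (FS_mat N F r) \<noteq> 0}"

definition alpha :: "nat \<Rightarrow> point set \<Rightarrow> real \<Rightarrow> point \<times> point \<Rightarrow> real" where
  "alpha N F r = (THE x. x \<in> extensional (F \<times> Dir N) \<and> fs_solution N F r x)"

text \<open>
  The product \<open>\<sigma>\<close>-algebra of finitely many copies of \<open>borel\<close> is the Borel \<open>\<sigma>\<close>-algebra of \<open>\<ell>\<^sub>1\<^sup>N\<close>.
  Only its measurable sets are used below.
\<close>

definition ell1_borel :: "nat \<Rightarrow> point measure" where
  "ell1_borel N = PiM {..<N} (\<lambda>_. borel)"

text \<open>
  A finite signed measure is a real-valued countably additive set function. As with \<open>measure\<close>, the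
  value on non-measurable sets is set to \<open>0\<close>, so that equal signed measures are equal functions.
\<close>

definition signed_measure :: "'a measure \<Rightarrow> ('a set \<Rightarrow> real) \<Rightarrow> bool" where
  "signed_measure M \<omega> \<longleftrightarrow>
     (\<forall>A. A \<notin> sets M \<longrightarrow> \<omega> A = 0) \<and>
     (\<forall>A. range A \<subseteq> sets M \<and> disjoint_family A \<longrightarrow> (\<lambda>i::nat. \<omega> (A i)) sums \<omega> (\<Union>i. A i))"

text \<open>
  Integration against a finite signed measure \<open>\<omega>\<close>, through a decomposition of \<open>\<omega>\<close> into a difference of
  two finite measures. One exists by the Jordan decomposition theorem, and the value of the integral
  is the same for all of them.
\<close>

definition has_signed_integral ::
    "'a measure \<Rightarrow> ('a set \<Rightarrow> real) \<Rightarrow> ('a \<Rightarrow> real) \<Rightarrow> real \<Rightarrow> bool" where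
  "has_signed_integral M \<omega> f I \<longleftrightarrow>
     (\<exists>\<mu> \<nu>. finite_measure \<mu> \<and> finite_measure \<nu> \<and> sets \<mu> = sets M \<and> sets \<nu> = sets M \<and>
        (\<forall>A\<in>sets M. \<omega> A = measure \<mu> A - measure \<nu> A) \<and>
        integrable \<mu> f \<and> integrable \<nu> f \<and>
        I = integral\<^sup>L \<mu> f - integral\<^sup>L \<nu> f)"

text \<open>
  A measure on \<open>K\<close> is identified with its extension by zero: a measure on the ambient space that
  vanishes on all measurable sets disjoint from \<open>K\<close>. Its integral over \<open>K\<close> is then its integral over
  the whole space.
\<close>

definition is_weight_measure :: "nat \<Rightarrow> point set \<Rightarrow> (point set \<Rightarrow> real) \<Rightarrow> bool" where
  "is_weight_measure N K \<omega> \<longleftrightarrow>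
     signed_measure (ell1_borel N) \<omega> \<and>
     (\<forall>A\<in>sets (ell1_borel N). A \<inter> K = {} \<longrightarrow> \<omega> A = 0) \<and>
     (\<forall>a\<in>K. has_signed_integral (ell1_borel N) \<omega> (\<lambda>x. exp (- d1 N x a)) 1)"

definition weight_measure :: "nat \<Rightarrow> point set \<Rightarrow> point set \<Rightarrow> real" where
  "weight_measure N K = (THE \<omega>. is_weight_measure N K \<omega>)"

definition mag :: "nat \<Rightarrow> point set \<Rightarrow> real" where
  "mag N K = weight_measure N K K"

definition weighting :: "nat \<Rightarrow> point set \<Rightarrow> point \<Rightarrow> real" where
  "weighting N F = (THE w. w \<in> extensional F \<and> (\<forall>p\<in>F. (\<Sum>q\<in>F. exp (- d1 N p q) * w q) = 1))"

definition mag_finite :: "nat \<Rightarrow> point set \<Rightarrow> real" where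
  "mag_finite N F = (\<Sum>p\<in>F. weighting N F p)"

definition omega_cubes :: "nat \<Rightarrow> point set \<Rightarrow> real \<Rightarrow> point set \<Rightarrow> real" where
  "omega_cubes N F r A =
     (\<Sum>p\<in>F. weight_measure N (cube N p r) A)
     - (\<Sum>(p, s)\<in>F \<times> Dir N. alpha N F r (p, s) * weight_measure N (face N p s r) A)"

end

theory Submission
  imports Defs
begin

text \<open>
  The kernel \<open>exp (- \<bar>x - y\<bar>)\<close> equals \<open>\<integral> ramp x t * ramp y t dt\<close> with \<open>ramp x t = \<surd>2 exp (x - t)\<close> for
  \<open>t \<ge> x\<close> and \<open>0\<close> otherwise. By Fubini the energy of a signed measure under \<open>exp (- d1)\<close> is the square
  integral of its transform against products of ramps, and these transforms determine the measure on
  all lower orthants. Hence weight measures are unique, and similarity matrices of finite sets are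
  nonsingular.

  A cube is the face with direction \<open>0\<close>. For \<open>q \<in> F\<close>, every \<open>(p, s)\<close> has exactly one direction
  \<open>u \<in> {-1, 0, 1}\<^sup>N\<close> as seen from \<open>q\<close>; on the cube at \<open>q\<close> the potentials of all faces with direction \<open>u\<close>
  are their values at the corner \<open>q + r u\<close> times one common factor. So summing the equations of the
  Fragment System over \<open>u\<close> gives potential \<open>1\<close> on all cubes.

  At \<open>r = 0\<close> the homogeneous system has only the zero solution: by induction on a set \<open>K\<close> of
  coordinates, the sums of a solution over all \<open>s\<close> with prescribed restriction to \<open>K\<close> vanish. The
  remaining claims are continuity (Cramer's rule) and summation of the system at \<open>r = 0\<close> over \<open>u\<close>.
\<close>

subsection \<open>Linear combinations of measures\<close>

text \<open>An integral against a signed measure is available only through some decomposition into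
  two finite measures, possibly a different one for each integrand. Differences of measures are
  therefore not formed: P1 - Q1 = P2 - Q2 is treated as an equality of the positive measures P1 + Q2
  and P2 + Q1, and integrals are exchanged only for nonnegative functions.

  The ramps are one-sided on purpose. Up to an exponential weight, a product of ramps is, as a
  function of x, the indicator of a lower orthant, so the transform can be inverted with a
  generating family of sets and no Fourier analysis.

  At r = 0 all faces at p collapse to p, so their potentials no longer distinguish the unknowns
  belonging to p. Only the index sets of the equations do, and this is what forces the induction
  over sets of coordinates.

  For the limits, the mass of every face tends to 1 as r tends to 0. The mass of the cube at q thus
  tends to the sum over s of the coefficients at r = 0, and these sums solve the equations of the
  weighting.\<close>

definition lin_comb_measure :: "'i set \<Rightarrow> ('i \<Rightarrow> ennreal) \<Rightarrow> ('i \<Rightarrow> 'a measure) \<Rightarrow> 'a measure \<Rightarrow> 'a measure" where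
  "lin_comb_measure I c m M = measure_of (space M) (sets M) (\<lambda>A. \<Sum>i\<in>I. c i * emeasure (m i) A)"

lemma sets_lin_comb [simp, measurable_cong]: "sets (lin_comb_measure I c m M) = sets M"
  by (simp add: lin_comb_measure_def sets.sigma_sets_eq)

lemma emeasure_lin_comb:
  assumes I: "finite I" and s: "\<And>i. i \<in> I \<Longrightarrow> sets (m i) = sets M" and A: "A \<in> sets M"
  shows "emeasure (lin_comb_measure I c m M) A = (\<Sum>i\<in>I. c i * emeasure (m i) A)"
  unfolding lin_comb_measure_def
proof (rule emeasure_measure_of_sigma[OF _ _ _ A])
  show "sigma_algebra (space M) (sets M)" by (rule sets.sigma_algebra_axioms)
  show "positive (sets M) (\<lambda>A. \<Sum>i\<in>I. c i * emeasure (m i) A)"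
    by (simp add: positive_def)
  show "countably_additive (sets M) (\<lambda>A. \<Sum>i\<in>I. c i * emeasure (m i) A)"
  proof (rule countably_additiveI)
    fix B :: "nat \<Rightarrow> 'b set"
    assume B: "range B \<subseteq> sets M" "disjoint_family B"
    have "(\<Sum>j. \<Sum>i\<in>I. c i * emeasure (m i) (B j)) = (\<Sum>i\<in>I. \<Sum>j. c i * emeasure (m i) (B j))"
      by (rule suminf_sum) simp
    also have "\<dots> = (\<Sum>i\<in>I. c i * emeasure (m i) (\<Union>j. B j))"
      using B s by (intro sum.cong refl) (simp add: suminf_emeasure)
    finally show "(\<Sum>j. \<Sum>i\<in>I. c i * emeasure (m i) (B j)) = (\<Sum>i\<in>I. c i * emeasure (m i) (\<Union>j. B j))" .
  qed
qed

lemma nn_integral_lin_comb: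
  assumes I: "finite I" and s: "\<And>i. i \<in> I \<Longrightarrow> sets (m i) = sets M" and f: "f \<in> borel_measurable M"
  shows "(\<integral>\<^sup>+x. f x \<partial>lin_comb_measure I c m M) = (\<Sum>i\<in>I. c i * (\<integral>\<^sup>+x. f x \<partial>m i))"
  using f
proof (induction rule: borel_measurable_induct)
  case (cong f g)
  have sp: "space (m i) = space M" if "i \<in> I" for i using s[OF that] by (rule sets_eq_imp_space_eq)
  have sp': "space (lin_comb_measure I c m M) = space M" by (rule sets_eq_imp_space_eq) simp
  have "(\<integral>\<^sup>+x. f x \<partial>lin_comb_measure I c m M) = (\<integral>\<^sup>+x. g x \<partial>lin_comb_measure I c m M)"
    using cong(3) sp' by (intro nn_integral_cong) auto
  moreover have "(\<integral>\<^sup>+x. f x \<partial>m i) = (\<integral>\<^sup>+x. g x \<partial>m i)" if "i \<in> I" for i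
    using cong(3) sp[OF that] by (intro nn_integral_cong) auto
  ultimately show ?case using cong(4) by simp
next
  case (set A)
  then show ?case using s by (simp add: emeasure_lin_comb[OF I s])
next
  case (mult u d)
  have [measurable]: "u \<in> borel_measurable (m i)" if "i \<in> I" for i
    using mult(2) s[OF that] by (simp cong: measurable_cong_sets)
  have [measurable]: "u \<in> borel_measurable M" by fact
  have "(\<integral>\<^sup>+x. d * u x \<partial>lin_comb_measure I c m M) = d * (\<integral>\<^sup>+x. u x \<partial>lin_comb_measure I c m M)"
    by (rule nn_integral_cmult) measurable
  also have "\<dots> = (\<Sum>i\<in>I. d * (c i * (\<integral>\<^sup>+x. u x \<partial>m i)))" by (simp add: mult.IH sum_distrib_left)
  also have "\<dots> = (\<Sum>i\<in>I. c i * (\<integral>\<^sup>+x. d * u x \<partial>m i))"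
    by (intro sum.cong refl) (simp add: nn_integral_cmult mult.left_commute)
  finally show ?case .
next
  case (add u v)
  have [measurable]: "u \<in> borel_measurable (m i)" "v \<in> borel_measurable (m i)" if "i \<in> I" for i
    using add s[OF that] by (simp_all cong: measurable_cong_sets)
  have [measurable]: "u \<in> borel_measurable M" "v \<in> borel_measurable M" by fact+
  have "(\<integral>\<^sup>+x. v x + u x \<partial>lin_comb_measure I c m M)
      = (\<integral>\<^sup>+x. v x \<partial>lin_comb_measure I c m M) + (\<integral>\<^sup>+x. u x \<partial>lin_comb_measure I c m M)"
    by (rule nn_integral_add) measurable
  also have "\<dots> = (\<Sum>i\<in>I. c i * (\<integral>\<^sup>+x. v x + u x \<partial>m i))"
    by (simp add: add.IH nn_integral_add sum.distrib distrib_left)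
  finally show ?case .
next
  case (seq U)
  have [measurable]: "U j \<in> borel_measurable (m i)" if "i \<in> I" for i j
    using seq(1) s[OF that] by (simp cong: measurable_cong_sets)
  have [measurable]: "\<And>j. U j \<in> borel_measurable M" by fact
  have "(\<integral>\<^sup>+x. (SUP j. U j) x \<partial>lin_comb_measure I c m M)
      = (SUP j. \<integral>\<^sup>+x. U j x \<partial>lin_comb_measure I c m M)"
    unfolding SUP_apply by (intro nn_integral_monotone_convergence_SUP seq) measurable
  also have "\<dots> = (SUP j. \<Sum>i\<in>I. c i * (\<integral>\<^sup>+x. U j x \<partial>m i))" by (simp add: seq)
  \<comment> \<open>Supremum and finite sum commute here because every summand increases with
    j.\<close>
  also have "\<dots> = (\<Sum>i\<in>I. SUP j. c i * (\<integral>\<^sup>+x. U j x \<partial>m i))"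
    using seq(3) by (intro ennreal_SUP_sum)
      (auto simp: incseq_def le_fun_def intro!: mult_left_mono nn_integral_mono)
  also have "\<dots> = (\<Sum>i\<in>I. c i * (\<integral>\<^sup>+x. (SUP j. U j) x \<partial>m i))"
    unfolding SUP_apply
    by (intro sum.cong refl, subst nn_integral_monotone_convergence_SUP)
      (auto simp: SUP_mult_left_ennreal seq)
  finally show ?case .
qed

lemma finite_measure_lin_comb:
  assumes "finite I" "\<And>i. i \<in> I \<Longrightarrow> sets (m i) = sets M" "\<And>i. i \<in> I \<Longrightarrow> finite_measure (m i)"
    "\<And>i. i \<in> I \<Longrightarrow> c i \<noteq> \<infinity>"
  shows "finite_measure (lin_comb_measure I c m M)"
proof (rule finite_measureI)
  have sp': "space (lin_comb_measure I c m M) = space M" by (rule sets_eq_imp_space_eq) simp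
  show "emeasure (lin_comb_measure I c m M) (space (lin_comb_measure I c m M)) \<noteq> \<infinity>"
    unfolding sp' using assms
    by (subst emeasure_lin_comb) (auto simp: ennreal_mult_eq_top_iff finite_measure.emeasure_finite)
qed

lemma measure_lin_comb:
  assumes I: "finite I" and s: "\<And>i. i \<in> I \<Longrightarrow> sets (m i) = sets M"
    and fin: "\<And>i. i \<in> I \<Longrightarrow> finite_measure (m i)" and c: "\<And>i. i \<in> I \<Longrightarrow> 0 \<le> c i" and A: "A \<in> sets M"
  shows "measure (lin_comb_measure I (\<lambda>i. ennreal (c i)) m M) A = (\<Sum>i\<in>I. c i * measure (m i) A)"
proof -
  have "emeasure (lin_comb_measure I (\<lambda>i. ennreal (c i)) m M) A = (\<Sum>i\<in>I. ennreal (c i * measure (m i) A))"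
    using c by (simp add: emeasure_lin_comb[OF I s A] finite_measure.emeasure_eq_measure[OF fin] ennreal_mult cong: sum.cong)
  also have "\<dots> = ennreal (\<Sum>i\<in>I. c i * measure (m i) A)"
    using c by (intro sum_ennreal) auto
  finally show ?thesis
    using c by (intro measure_eq_emeasure_eq_ennreal sum_nonneg) auto
qed

lemma integral_lin_comb:
  fixes f :: "'a \<Rightarrow> real"
  assumes I: "finite I" and s: "\<And>i. i \<in> I \<Longrightarrow> sets (m i) = sets M"
    and fin: "\<And>i. i \<in> I \<Longrightarrow> finite_measure (m i)" and c: "\<And>i. i \<in> I \<Longrightarrow> 0 \<le> c i"
    and f: "f \<in> borel_measurable M" "\<And>x. 0 \<le> f x" "\<And>x. f x \<le> b"
  shows "(\<integral>x. f x \<partial>lin_comb_measure I (\<lambda>i. ennreal (c i)) m M) = (\<Sum>i\<in>I. c i * (\<integral>x. f x \<partial>m i))"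
proof -
  have [measurable]: "f \<in> borel_measurable (m i)" if "i \<in> I" for i
    using f s[OF that] by (simp cong: measurable_cong_sets)
  have i: "integrable (m i) f" if "i \<in> I" for i
    using f that by (intro finite_measure.integrable_const_bound[OF fin, where B=b]) auto
  have "(\<integral>\<^sup>+x. ennreal (f x) \<partial>lin_comb_measure I (\<lambda>i. ennreal (c i)) m M) = (\<Sum>i\<in>I. ennreal (c i) * (\<integral>\<^sup>+x. ennreal (f x) \<partial>m i))"
    using f by (intro nn_integral_lin_comb I s) auto
  also have "\<dots> = (\<Sum>i\<in>I. ennreal (c i * (\<integral>x. f x \<partial>m i)))"
    using i f c by (intro sum.cong refl) (simp add: nn_integral_eq_integral ennreal_mult)
  also have "\<dots> = ennreal (\<Sum>i\<in>I. c i * (\<integral>x. f x \<partial>m i))"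
    using c f by (intro sum_ennreal) auto
  finally show ?thesis
    using f c by (subst integral_eq_nn_integral)
      (auto intro!: enn2real_ennreal sum_nonneg mult_nonneg_nonneg integral_nonneg)
qed

text \<open>Stated with sums so that it compares two decompositions P - Q = P' - Q' of one signed
  measure, read as P + Q' = P' + Q. It makes the integral against a signed measure independent of
  the decomposition.\<close>

lemma integral_add_cong:
  fixes f :: "'a \<Rightarrow> real"
  assumes fin: "finite_measure A" "finite_measure B" "finite_measure C" "finite_measure D"
    and sets: "sets A = sets M" "sets B = sets M" "sets C = sets M" "sets D = sets M"
    and eq: "\<And>S. S \<in> sets M \<Longrightarrow> measure A S + measure B S = measure C S + measure D S"
    and f: "f \<in> borel_measurable M" "\<And>x. 0 \<le> f x" "\<And>x. f x \<le> b"
  shows "(\<integral>x. f x \<partial>A) + (\<integral>x. f x \<partial>B) = (\<integral>x. f x \<partial>C) + (\<integral>x. f x \<partial>D)"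
proof -
  \<comment> \<open>The sum of two measures is a combination indexed by the type
    \<open>bool\<close>, both coefficients being 1.\<close>
  define add where "add = (\<lambda>P Q. lin_comb_measure UNIV (\<lambda>b::bool. ennreal 1) (\<lambda>b. if b then P else Q) M)"
  have fin_add: "finite_measure (add P Q)"
    if "finite_measure P" "finite_measure Q" "sets P = sets M" "sets Q = sets M" for P Q
    unfolding add_def using that by (intro finite_measure_lin_comb) auto
  have measure_add: "measure (add P Q) S = measure P S + measure Q S"
    if "finite_measure P" "finite_measure Q" "sets P = sets M" "sets Q = sets M" "S \<in> sets M" for P Q S
    unfolding add_def using that by (subst measure_lin_comb) (auto simp: UNIV_bool)
  have integral_add: "(\<integral>x. f x \<partial>add P Q) = (\<integral>x. f x \<partial>P) + (\<integral>x. f x \<partial>Q)"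
    if "finite_measure P" "finite_measure Q" "sets P = sets M" "sets Q = sets M" for P Q
    unfolding add_def using that f by (subst integral_lin_comb[where b=b]) (auto simp: UNIV_bool)
  have "add A B = add C D"
  proof (rule measure_eqI)
    show "sets (add A B) = sets (add C D)" by (simp add: add_def)
    fix S assume "S \<in> sets (add A B)"
    then have "S \<in> sets M" by (simp add: add_def)
    then show "emeasure (add A B) S = emeasure (add C D) S"
      using fin sets eq by (simp add: finite_measure.emeasure_eq_measure[OF fin_add] measure_add)
  qed
  then show ?thesis
    using integral_add[OF fin(1,2) sets(1,2)] integral_add[OF fin(3,4) sets(3,4)] by simp
qed

lemma signed_measure_lin_comb:
  fixes m :: "'i \<Rightarrow> 'a measure"
  assumes fin: "\<And>i. i \<in> I \<Longrightarrow> finite_measure (m i)"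
    and sets: "\<And>i. i \<in> I \<Longrightarrow> sets (m i) = sets M"
  shows "signed_measure M (\<lambda>A. \<Sum>i\<in>I. c i * measure (m i) A)"
  unfolding signed_measure_def
proof (intro conjI allI impI)
  fix A assume "A \<notin> sets M"
  then have "measure (m i) A = 0" if "i \<in> I" for i using sets[OF that] by (simp add: measure_notin_sets)
  then show "(\<Sum>i\<in>I. c i * measure (m i) A) = 0" by simp
next
  fix A :: "nat \<Rightarrow> 'a set" assume A: "range A \<subseteq> sets M \<and> disjoint_family A"
  show "(\<lambda>j. \<Sum>i\<in>I. c i * measure (m i) (A j)) sums (\<Sum>i\<in>I. c i * measure (m i) (\<Union>j. A j))"
    using A sets by (intro sums_sum sums_mult finite_measure.finite_measure_UNION fin) auto
qed

text \<open>The witnesses collect the positive and the negative parts of the coefficients. They need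
  not form the Jordan decomposition, since \<open>m i\<close> and \<open>m j\<close> may overlap.
  The bound b makes f integrable for both.\<close>

lemma has_signed_integral_lin_comb:
  assumes I: "finite I"
    and fin: "\<And>i. i \<in> I \<Longrightarrow> finite_measure (m i)"
    and sets: "\<And>i. i \<in> I \<Longrightarrow> sets (m i) = sets M"
    and f: "f \<in> borel_measurable M" "\<And>x. 0 \<le> f x" "\<And>x. f x \<le> b"
  shows "has_signed_integral M (\<lambda>A. \<Sum>i\<in>I. c i * measure (m i) A) f (\<Sum>i\<in>I. c i * (\<integral>x. f x \<partial>m i))"
proof -
  let ?P = "lin_comb_measure I (\<lambda>i. ennreal (max (c i) 0)) m M"
  let ?Q = "lin_comb_measure I (\<lambda>i. ennreal (max (- c i) 0)) m M"
  have c: "max (c i) 0 - max (- c i) 0 = c i" for i by (auto simp: max_def)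
  have finPQ: "finite_measure ?P" "finite_measure ?Q"
    using fin sets I by (auto intro!: finite_measure_lin_comb)
  have [measurable]: "f \<in> borel_measurable ?P" "f \<in> borel_measurable ?Q"
    using f by (simp_all cong: measurable_cong_sets)
  have int: "integrable ?P f" "integrable ?Q f"
    using finPQ f by (auto intro!: finite_measure.integrable_const_bound[where B=b])
  have "measure ?P A - measure ?Q A = (\<Sum>i\<in>I. c i * measure (m i) A)" if "A \<in> sets M" for A
    using that fin sets I
    by (simp add: measure_lin_comb sum_subtractf[symmetric] left_diff_distrib[symmetric] c)
  moreover have "(\<integral>x. f x \<partial>?P) - (\<integral>x. f x \<partial>?Q) = (\<Sum>i\<in>I. c i * (\<integral>x. f x \<partial>m i))"
    using fin sets I f
    by (simp add: integral_lin_comb[where b=b] sum_subtractf[symmetric] left_diff_distrib[symmetric] c)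
  ultimately show ?thesis
    unfolding has_signed_integral_def using finPQ int
    by (intro exI[of _ ?P] exI[of _ ?Q]) simp
qed

subsection \<open>Energy of the exponential kernel\<close>

abbreviation ell1_lborel :: "nat \<Rightarrow> point measure" where
  "ell1_lborel N \<equiv> PiM {..<N} (\<lambda>_. lborel)"

lemma space_ell1_borel: "space (ell1_borel N) = {..<N} \<rightarrow>\<^sub>E UNIV"
  by (simp add: ell1_borel_def space_PiM)

lemma sets_ell1_lborel [measurable_cong]: "sets (ell1_lborel N) = sets (ell1_borel N)"
  unfolding ell1_borel_def by (intro sets_PiM_cong) auto

lemma measurable_component [measurable]: "k < N \<Longrightarrow> (\<lambda>x. x k) \<in> borel_measurable (ell1_borel N)"
  unfolding ell1_borel_def by measurable

lemma measurable_d1 [measurable]: "(\<lambda>x. d1 N x a) \<in> borel_measurable (ell1_borel N)"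
  unfolding d1_def by measurable

lemma measurable_d1_pair [measurable]:
  "(\<lambda>(x, y). d1 N x y) \<in> borel_measurable (ell1_borel N \<Otimes>\<^sub>M ell1_borel N)"
  unfolding d1_def by measurable

lemma d1_commute: "d1 N x y = d1 N y x"
  unfolding d1_def by (intro sum.cong refl) auto

lemma d1_nonneg: "0 \<le> d1 N x y"
  unfolding d1_def by (intro sum_nonneg) auto

text \<open>The support in t is a closed half-line, which gives continuity from the right in t. As a
  function of x, the ramp is exp x, up to a constant factor, restricted to the half-line below
  t.\<close>

definition ramp :: "real \<Rightarrow> real \<Rightarrow> real" where
  "ramp x t = (if x \<le> t then sqrt 2 * exp (x - t) else 0)"

definition ramps :: "nat \<Rightarrow> point \<Rightarrow> point \<Rightarrow> real" where
  "ramps N x t = (\<Prod>k<N. ramp (x k) (t k))"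

lemma ramp_nonneg: "0 \<le> ramp x t" and ramp_le: "ramp x t \<le> sqrt 2"
  by (auto simp: ramp_def)

lemma ramps_nonneg: "0 \<le> ramps N x t"
  unfolding ramps_def by (intro prod_nonneg) (auto simp: ramp_nonneg)

lemma ramps_le: "ramps N x t \<le> sqrt 2 ^ N"
proof -
  have "ramps N x t \<le> (\<Prod>k<N. sqrt 2)"
    unfolding ramps_def by (intro prod_mono) (auto simp: ramp_nonneg ramp_le)
  then show ?thesis by simp
qed

lemma measurable_ramp [measurable]: 
  assumes [measurable]: "f \<in> borel_measurable M" "g \<in> borel_measurable M"
  shows "(\<lambda>x. ramp (f x) (g x)) \<in> borel_measurable M"
  unfolding ramp_def by measurable

lemma measurable_ramps [measurable]:
  "(\<lambda>x. ramps N x t) \<in> borel_measurable (ell1_borel N)"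
  "ramps N x \<in> borel_measurable (ell1_borel N)"
  unfolding ramps_def[abs_def] by measurable

lemma measurable_ramps_pair [measurable]:
  "(\<lambda>(x, t). ramps N x t) \<in> borel_measurable (ell1_borel N \<Otimes>\<^sub>M ell1_borel N)"
  "(\<lambda>(t, x). ramps N x t) \<in> borel_measurable (ell1_borel N \<Otimes>\<^sub>M ell1_borel N)"
  unfolding ramps_def by measurable

lemma nn_integral_ramp:
  "(\<integral>\<^sup>+t. ennreal (ramp x t * ramp y t) \<partial>lborel) = ennreal (exp (- \<bar>x - y\<bar>))"
proof -
  \<comment> \<open>Both ramps live on t \<ge> a. There the two factors sqrt 2 supply the 2 in 2 exp
    (x + y - 2 t), which integrates to exp (x + y - 2 a), and x + y - 2 a is -|x - y|.\<close>
  define a where "a = max x y"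
  have "ennreal (ramp x t * ramp y t) = ennreal (2 * exp (x + y - 2 * t)) * indicator {a..} t" for t
  proof (cases "t \<ge> a")
    case True
    then have "x \<le> t" "y \<le> t" by (auto simp: a_def)
    then have "ramp x t * ramp y t = (sqrt 2 * sqrt 2) * (exp (x - t) * exp (y - t))"
      unfolding ramp_def by simp
    also have "\<dots> = 2 * exp (x + y - 2 * t)" by (simp add: exp_add[symmetric] algebra_simps)
    finally show ?thesis using True by simp
  qed (auto simp: a_def ramp_def)
  then have "(\<integral>\<^sup>+t. ennreal (ramp x t * ramp y t) \<partial>lborel)
      = (\<integral>\<^sup>+t. ennreal (2 * exp (x + y - 2 * t)) * indicator {a..} t \<partial>lborel)" by simp
  also have "\<dots> = ennreal (0 - (- exp (x + y - 2 * a)))"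
  proof (rule nn_integral_FTC_atLeast)
    show "((\<lambda>t. - exp (x + y - 2 * t)) has_real_derivative 2 * exp (x + y - 2 * t)) (at t)" for t
      by (auto intro!: derivative_eq_intros)
    have "((\<lambda>t. exp (x + y - 2 * t)) \<longlongrightarrow> 0) at_top"
      by real_asymp
    from tendsto_minus[OF this] show "((\<lambda>t. - exp (x + y - 2 * t)) \<longlongrightarrow> 0) at_top" by simp
  qed auto
  also have "0 - (- exp (x + y - 2 * a)) = exp (- \<bar>x - y\<bar>)"
    by (auto simp: a_def max_def abs_if)
  finally show ?thesis .
qed

lemma nn_integral_ramps:
  "(\<integral>\<^sup>+t. ennreal (ramps N x t * ramps N y t) \<partial>ell1_lborel N) = ennreal (exp (- d1 N x y))"
proof -
  interpret product_sigma_finite "\<lambda>_::nat. lborel :: real measure"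
    by standard
  have "(\<integral>\<^sup>+t. ennreal (ramps N x t * ramps N y t) \<partial>ell1_lborel N)
     = (\<integral>\<^sup>+t. (\<Prod>k<N. ennreal (ramp (x k) (t k) * ramp (y k) (t k))) \<partial>ell1_lborel N)"
    by (intro nn_integral_cong)
      (simp add: ramps_def prod.distrib[symmetric] prod_ennreal ramp_nonneg)
  also have "\<dots> = (\<Prod>k<N. \<integral>\<^sup>+t. ennreal (ramp (x k) t * ramp (y k) t) \<partial>lborel)"
    by (rule product_nn_integral_prod) auto
  also have "\<dots> = (\<Prod>k<N. ennreal (exp (- \<bar>x k - y k\<bar>)))" by (simp add: nn_integral_ramp)
  also have "\<dots> = ennreal (exp (- d1 N x y))"
    by (simp add: prod_ennreal d1_def exp_sum sum_negf[symmetric])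
  finally show ?thesis .
qed

lemma integrable_bounded:
  fixes f :: "'a \<Rightarrow> real"
  assumes "finite_measure A" "f \<in> borel_measurable A" "\<And>x. 0 \<le> f x" "\<And>x. f x \<le> b"
  shows "integrable A f"
  using assms by (intro finite_measure.integrable_const_bound[where B=b] AE_I2) (simp_all add: abs_of_nonneg)

context
  fixes N :: nat and A :: "point measure"
  assumes fA: "finite_measure A" and sA [measurable_cong]: "sets A = sets (ell1_borel N)"
begin

lemma nn_integral_ramps_eq:
  "(\<integral>\<^sup>+x. ennreal (ramps N x t) \<partial>A) = ennreal (\<integral>x. ramps N x t \<partial>A)"
  by (intro nn_integral_eq_integral integrable_bounded[OF fA])
    (auto simp: ramps_nonneg intro: ramps_le)

lemma integral_kernel_nonneg_le:
  "0 \<le> (\<integral>y. exp (- d1 N x y) \<partial>A)" "(\<integral>y. exp (- d1 N x y) \<partial>A) \<le> measure A (space A)"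
proof -
  have [measurable]: "(\<lambda>y. d1 N x y) \<in> borel_measurable (ell1_borel N)"
    unfolding d1_commute[of N x] by measurable
  show "0 \<le> (\<integral>y. exp (- d1 N x y) \<partial>A)" by simp
  have "(\<integral>y. exp (- d1 N x y) \<partial>A) \<le> (\<integral>y. 1 \<partial>A)"
    using fA by (intro integral_mono integrable_bounded[where b=1])
      (auto simp: d1_nonneg finite_measure.integrable_const)
  then show "(\<integral>y. exp (- d1 N x y) \<partial>A) \<le> measure A (space A)" by simp
qed

lemma measurable_integral_kernel [measurable]:
  "(\<lambda>x. \<integral>y. exp (- d1 N x y) \<partial>A) \<in> borel_measurable (ell1_borel N)"
proof -
  interpret finite_measure A by (rule fA)
  show ?thesis by measurable
qed

end

text \<open>All exchanges take place among nonnegative integrals, so Tonelli applies without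
  integrability conditions. Finiteness comes last: the kernel is at most 1 and both measures are
  finite, which turns the result into a Bochner integral.\<close>

lemma energy_ramps:
  assumes fA: "finite_measure A" and fB: "finite_measure B"
    and sA [measurable_cong]: "sets A = sets (ell1_borel N)"
    and sB [measurable_cong]: "sets B = sets (ell1_borel N)"
  shows "has_bochner_integral (ell1_lborel N) (\<lambda>t. (\<integral>x. ramps N x t \<partial>A) * (\<integral>x. ramps N x t \<partial>B))
    (\<integral>x. \<integral>y. exp (- d1 N x y) \<partial>B \<partial>A)"
proof -
  interpret A: finite_measure A by (rule fA)
  interpret B: finite_measure B by (rule fB)
  interpret P: product_sigma_finite "\<lambda>_::nat. lborel :: real measure"
    by standard
  interpret L: sigma_finite_measure "ell1_lborel N"
    by (rule P.sigma_finite) simp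
  interpret AL: pair_sigma_finite A "ell1_lborel N" ..
  interpret BL: pair_sigma_finite B "ell1_lborel N" ..
  note [measurable] = measurable_integral_kernel[OF fB sB]
  have [measurable]: "(\<lambda>y. d1 N x y) \<in> borel_measurable (ell1_borel N)" for x
    unfolding d1_commute[of N x] by measurable
  have "(\<integral>\<^sup>+x. ennreal (\<integral>y. exp (- d1 N x y) \<partial>B) \<partial>A) = (\<integral>\<^sup>+x. \<integral>\<^sup>+y. ennreal (exp (- d1 N x y)) \<partial>B \<partial>A)"
    by (intro nn_integral_cong nn_integral_eq_integral[symmetric] integrable_bounded[OF fB, where b=1])
      (auto simp: d1_nonneg)
  also have "\<dots> = (\<integral>\<^sup>+x. \<integral>\<^sup>+y. \<integral>\<^sup>+t. ennreal (ramps N x t) * ennreal (ramps N y t) \<partial>ell1_lborel N \<partial>B \<partial>A)"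
    by (simp add: nn_integral_ramps[symmetric] ennreal_mult ramps_nonneg)
  also have "\<dots> = (\<integral>\<^sup>+x. \<integral>\<^sup>+t. \<integral>\<^sup>+y. ennreal (ramps N x t) * ennreal (ramps N y t) \<partial>B \<partial>ell1_lborel N \<partial>A)"
    by (intro nn_integral_cong BL.Fubini'[symmetric]) measurable
  also have "\<dots> = (\<integral>\<^sup>+x. \<integral>\<^sup>+t. ennreal (ramps N x t) * ennreal (\<integral>y. ramps N y t \<partial>B) \<partial>ell1_lborel N \<partial>A)"
    by (intro nn_integral_cong) (simp add: nn_integral_cmult nn_integral_ramps_eq[OF fB sB])
  also have "\<dots> = (\<integral>\<^sup>+t. \<integral>\<^sup>+x. ennreal (ramps N x t) * ennreal (\<integral>y. ramps N y t \<partial>B) \<partial>A \<partial>ell1_lborel N)"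
    by (intro AL.Fubini'[symmetric]) measurable
  also have "\<dots> = (\<integral>\<^sup>+t. ennreal ((\<integral>x. ramps N x t \<partial>A) * (\<integral>y. ramps N y t \<partial>B)) \<partial>ell1_lborel N)"
    by (intro nn_integral_cong)
      (simp add: nn_integral_multc nn_integral_ramps_eq[OF fA sA] ennreal_mult ramps_nonneg)
  finally have eq: "(\<integral>\<^sup>+t. ennreal ((\<integral>x. ramps N x t \<partial>A) * (\<integral>y. ramps N y t \<partial>B)) \<partial>ell1_lborel N)
      = (\<integral>\<^sup>+x. ennreal (\<integral>y. exp (- d1 N x y) \<partial>B) \<partial>A)" ..
  also have "\<dots> = ennreal (\<integral>x. \<integral>y. exp (- d1 N x y) \<partial>B \<partial>A)"
    by (intro nn_integral_eq_integral integrable_bounded[OF fA])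
      (auto intro: integral_kernel_nonneg_le[OF fB sB])
  finally show ?thesis
    by (intro has_bochner_integral_nn_integral) (auto simp: ramps_nonneg)
qed

section \<open>Recovery of a finite measure from its ramp transform\<close>

lemma ramp_right_continuous:
  assumes "u \<longlonglongrightarrow> t" "\<And>n::nat. t \<le> u n"
  shows "(\<lambda>n. ramp x (u n)) \<longlonglongrightarrow> ramp x t"
proof (cases "x \<le> t")
  case True
  then have "x \<le> u n" for n using assms(2)[of n] by linarith
  then have "(\<lambda>n. ramp x (u n)) = (\<lambda>n. sqrt 2 * exp (x - u n))" by (auto simp: ramp_def)
  moreover have "(\<lambda>n. sqrt 2 * exp (x - u n)) \<longlonglongrightarrow> sqrt 2 * exp (x - t)"
    by (intro tendsto_intros assms)
  ultimately show ?thesis using True by (simp add: ramp_def)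
next
  case False
  then have "eventually (\<lambda>n. u n < x) sequentially"
    by (intro order_tendstoD[OF assms(1)]) auto
  then have "eventually (\<lambda>n. ramp x (u n) = 0) sequentially"
    by eventually_elim (auto simp: ramp_def)
  then show ?thesis using False by (simp add: ramp_def tendsto_eventually)
qed

lemma sigma_sets_lower_orthants:
  "sets (ell1_borel N) = sigma_sets ({..<N} \<rightarrow>\<^sub>E UNIV) {\<Pi>\<^sub>E k\<in>{..<N}. {..a k} | a. True}"
proof -
  \<comment> \<open>\<open>sets_PiM_sigma\<close> asks for a countable cover of the line by
    generators; the half-lines up to natural numbers are one.\<close>
  have "\<exists>S\<subseteq>range (\<lambda>a::real. {..a}). countable S \<and> UNIV = \<Union>S"
    by (intro exI[of _ "range (\<lambda>n::nat. {..real n})"]) (auto intro: real_arch_simple)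
  then have "sets (PiM {..<N} (\<lambda>_. sigma UNIV (range (\<lambda>a::real. {..a}))))
    = sets (sigma ({..<N} \<rightarrow>\<^sub>E UNIV) {{f\<in>{..<N} \<rightarrow>\<^sub>E UNIV. \<forall>i\<in>j. f i \<in> A i} |A j.
        j \<in> {{..<N}} \<and> A \<in> (Pi j (\<lambda>_. range (\<lambda>a::real. {..a})))})"
    by (intro sets_PiM_sigma) auto
  also have "{{f\<in>{..<N} \<rightarrow>\<^sub>E UNIV. \<forall>i\<in>j. f i \<in> A i} |A j.
        j \<in> {{..<N}} \<and> A \<in> (Pi j (\<lambda>_. range (\<lambda>a::real. {..a})))} = {\<Pi>\<^sub>E k\<in>{..<N}. {..a k} | a. True}"
    (is "?L = ?R")
  proof (intro equalityI subsetI)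
    fix X assume "X \<in> ?L"
    then obtain A where A: "X = {f\<in>{..<N} \<rightarrow>\<^sub>E UNIV. \<forall>i\<in>{..<N}. f i \<in> A i}"
      "A \<in> Pi {..<N} (\<lambda>_. range (\<lambda>a::real. {..a}))" by auto
    then have "\<forall>k\<in>{..<N}. \<exists>a. A k = {..a}" by auto
    then obtain a where "\<forall>k\<in>{..<N}. A k = {..a k}" by metis
    then have "X = (\<Pi>\<^sub>E k\<in>{..<N}. {..a k})" unfolding A by (auto simp: PiE_iff extensional_def)
    then show "X \<in> ?R" by blast
  next
    fix X assume "X \<in> ?R"
    then obtain a where "X = (\<Pi>\<^sub>E k\<in>{..<N}. {..a k})" by blast
    then have "X = {f\<in>{..<N} \<rightarrow>\<^sub>E UNIV. \<forall>i\<in>{..<N}. f i \<in> {..a i}}" by (auto simp: PiE_iff extensional_def)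
    moreover have "(\<lambda>k. {..a k}) \<in> Pi {..<N} (\<lambda>_. range (\<lambda>a::real. {..a}))" by auto
    ultimately show "X \<in> ?L"
      by (intro CollectI exI[of _ "\<lambda>k. {..a k}"] exI[of _ "{..<N}"]) auto
  qed
  also have "sets (sigma ({..<N} \<rightarrow>\<^sub>E UNIV) {\<Pi>\<^sub>E k\<in>{..<N}. {..a k::real} | a. True})
    = sigma_sets ({..<N} \<rightarrow>\<^sub>E UNIV) {\<Pi>\<^sub>E k\<in>{..<N}. {..a k} | a. True}"
    by (intro sets_measure_of) auto
  finally show ?thesis unfolding ell1_borel_def borel_eq_atMost .
qed

lemma ramps_right_continuous:
  assumes "\<And>k. k < N \<Longrightarrow> (\<lambda>n. u n k) \<longlonglongrightarrow> t k" "\<And>k n. k < N \<Longrightarrow> t k \<le> u (n::nat) k"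
  shows "(\<lambda>n. ramps N x (u n)) \<longlonglongrightarrow> ramps N x t"
  unfolding ramps_def using assms by (intro tendsto_prod ramp_right_continuous) auto

text \<open>Every nondegenerate box has positive Lebesgue measure and so contains a point where the
  transforms agree. Such points are taken ever closer to t, and dominated convergence, with the
  bound on ramps, carries the equality to t itself.\<close>

lemma integral_ramps_eq:
  assumes fA: "finite_measure A" and fB: "finite_measure B"
    and sA [measurable_cong]: "sets A = sets (ell1_borel N)"
    and sB [measurable_cong]: "sets B = sets (ell1_borel N)"
    and AE: "AE t in ell1_lborel N. (\<integral>x. ramps N x t \<partial>A) = (\<integral>x. ramps N x t \<partial>B)"
  shows "(\<integral>x. ramps N x t \<partial>A) = (\<integral>x. ramps N x t \<partial>B)"
proof -
  interpret P: product_sigma_finite "\<lambda>_::nat. lborel :: real measure"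
    by standard
  \<comment> \<open>The boxes have t as their lower corner because ramps are continuous only from
    the right: the approximating points must stay above t in every coordinate.\<close>
  let ?X = "\<lambda>n. \<Pi>\<^sub>E k\<in>{..<N}. {t k..t k + 1 / Suc n}"
  have "\<exists>s. s \<in> ?X n \<and> (\<integral>x. ramps N x s \<partial>A) = (\<integral>x. ramps N x s \<partial>B)" for n
  proof (rule ccontr)
    assume neg: "\<not> ?thesis"
    obtain Z where Z: "{s \<in> space (ell1_lborel N). \<not> (\<integral>x. ramps N x s \<partial>A) = (\<integral>x. ramps N x s \<partial>B)} \<subseteq> Z"
      "emeasure (ell1_lborel N) Z = 0" "Z \<in> sets (ell1_lborel N)"
      using AE by (rule AE_E)
    have "?X n \<subseteq> Z" using neg Z(1) by (force simp: space_PiM PiE_iff)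
    then have "emeasure (ell1_lborel N) (?X n) \<le> 0"
      using Z by (metis emeasure_mono)
    moreover have "emeasure (ell1_lborel N) (?X n) = (\<Prod>k<N. emeasure lborel {t k..t k + 1 / Suc n})"
      by (rule P.emeasure_PiM) auto
    ultimately show False by auto
  qed
  then obtain s where s: "\<And>n. s n \<in> ?X n"
    "\<And>n. (\<integral>x. ramps N x (s n) \<partial>A) = (\<integral>x. ramps N x (s n) \<partial>B)" by metis
  have lim: "(\<lambda>n. s n k) \<longlonglongrightarrow> t k" if "k < N" for k
  proof (rule tendsto_sandwich)
    show "eventually (\<lambda>n. t k \<le> s n k) sequentially" "eventually (\<lambda>n. s n k \<le> t k + 1 / Suc n) sequentially"
      using s(1) that by (auto simp: PiE_iff)
    show "(\<lambda>n. t k + 1 / Suc n) \<longlonglongrightarrow> t k"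
      using tendsto_add[OF tendsto_const LIMSEQ_inverse_real_of_nat, of "t k"] by (simp add: inverse_eq_divide)
  qed simp
  have ge: "t k \<le> s n k" if "k < N" for k n using s(1)[of n] that by (auto simp: PiE_iff)
  have conv: "(\<lambda>n. \<integral>x. ramps N x (s n) \<partial>M) \<longlonglongrightarrow> (\<integral>x. ramps N x t \<partial>M)"
    if M: "finite_measure M" and [measurable_cong]: "sets M = sets (ell1_borel N)" for M
  proof (rule integral_dominated_convergence[where w="\<lambda>_. sqrt 2 ^ N"])
    show "integrable M (\<lambda>_. sqrt 2 ^ N :: real)" by (rule finite_measure.integrable_const[OF M])
    show "AE x in M. (\<lambda>n. ramps N x (s n)) \<longlonglongrightarrow> ramps N x t"
      using lim ge by (intro AE_I2 ramps_right_continuous) auto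
    show "AE x in M. norm (ramps N x (s n)) \<le> sqrt 2 ^ N" for n
      using ramps_le by (auto simp: ramps_nonneg)
  qed measurable
  show ?thesis
    using LIMSEQ_unique[OF conv[OF fA sA]] conv[OF fB sB] s(2) by simp
qed

text \<open>The density exp (sum of the x k) cancels the x-dependence of the ramps and leaves a
  multiple of the indicator of the lower orthant at t. The weighted measures therefore agree on
  lower orthants, which generate the sigma-algebra and are closed under intersection; the reciprocal
  density then removes the weight.\<close>

lemma measure_eqI_ramps:
  assumes fA: "finite_measure A" and fB: "finite_measure B"
    and sA [measurable_cong]: "sets A = sets (ell1_borel N)"
    and sB [measurable_cong]: "sets B = sets (ell1_borel N)"
    and eq: "\<And>t. (\<integral>x. ramps N x t \<partial>A) = (\<integral>x. ramps N x t \<partial>B)"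
  shows "A = B"
proof -
  let ?e = "\<lambda>x::point. ennreal (exp (\<Sum>k<N. x k))"
  let ?i = "\<lambda>x::point. ennreal (exp (- (\<Sum>k<N. x k)))"
  let ?O = "\<lambda>a::point. \<Pi>\<^sub>E k\<in>{..<N}. {..a k}"
  have O [measurable]: "?O a \<in> sets (ell1_borel N)" for a
    unfolding ell1_borel_def by (intro sets_PiM_I_finite) auto
  have factor: "?e x * indicator (?O t) x = ennreal (exp (\<Sum>k<N. t k) / sqrt 2 ^ N) * ennreal (ramps N x t)"
    if "x \<in> {..<N} \<rightarrow>\<^sub>E UNIV" for x t
  proof (cases "\<forall>k<N. x k \<le> t k")
    case True
    then have "ramps N x t = (\<Prod>k<N. sqrt 2 * exp (x k - t k))"
      unfolding ramps_def by (intro prod.cong refl) (auto simp: ramp_def)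
    also have "\<dots> = sqrt 2 ^ N * (exp (\<Sum>k<N. x k) / exp (\<Sum>k<N. t k))"
      by (simp add: prod.distrib prod_dividef exp_sum exp_diff)
    finally have "exp (\<Sum>k<N. x k) = exp (\<Sum>k<N. t k) / sqrt 2 ^ N * ramps N x t" by simp
    then have "?e x = ennreal (exp (\<Sum>k<N. t k) / sqrt 2 ^ N) * ennreal (ramps N x t)"
      by (simp add: ennreal_mult[symmetric] ramps_nonneg)
    moreover have "x \<in> ?O t" using True that by (auto simp: PiE_iff)
    ultimately show ?thesis by simp
  next
    case False
    then have "ramps N x t = 0" unfolding ramps_def by (auto simp: ramp_def)
    moreover have "x \<notin> ?O t" using False by (auto simp: PiE_iff)
    ultimately show ?thesis by simp
  qed
  have em: "emeasure (density M ?e) (?O t) = ennreal (exp (\<Sum>k<N. t k) / sqrt 2 ^ N) * ennreal (\<integral>x. ramps N x t \<partial>M)"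
    if M: "finite_measure M" and sM [measurable_cong]: "sets M = sets (ell1_borel N)" for M t
  proof -
    have sp: "space M = {..<N} \<rightarrow>\<^sub>E UNIV"
      using sets_eq_imp_space_eq[OF sM] by (simp add: space_ell1_borel)
    have "emeasure (density M ?e) (?O t) = (\<integral>\<^sup>+x. ?e x * indicator (?O t) x \<partial>M)"
      by (intro emeasure_density) measurable
    also have "\<dots> = (\<integral>\<^sup>+x. ennreal (exp (\<Sum>k<N. t k) / sqrt 2 ^ N) * ennreal (ramps N x t) \<partial>M)"
      by (intro nn_integral_cong factor) (simp add: sp)
    also have "\<dots> = ennreal (exp (\<Sum>k<N. t k) / sqrt 2 ^ N) * ennreal (\<integral>x. ramps N x t \<partial>M)"
      by (subst nn_integral_cmult) (simp_all add: nn_integral_ramps_eq[OF M sM])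
    finally show ?thesis .
  qed
  have "density A ?e = density B ?e"
  proof (rule measure_eqI_generator_eq[where E="{?O a | a. True}" and \<Omega>="{..<N} \<rightarrow>\<^sub>E UNIV" and A="\<lambda>n. ?O (\<lambda>_. real n)"])
    show "Int_stable {?O a | a. True}"
      unfolding Int_stable_def
    proof (intro ballI)
      fix X Y assume "X \<in> {?O a | a. True}" "Y \<in> {?O a | a. True}"
      then obtain a b where "X = ?O a" "Y = ?O b" by blast
      then have "X \<inter> Y = ?O (\<lambda>k. min (a k) (b k))" by (simp add: PiE_Int)
      then show "X \<inter> Y \<in> {?O a | a. True}"
        by (intro CollectI exI[of _ "\<lambda>k. min (a k) (b k)"]) simp
    qed
    show "{?O a | a. True} \<subseteq> Pow ({..<N} \<rightarrow>\<^sub>E UNIV)" by (auto simp: PiE_iff)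
    show "emeasure (density A ?e) X = emeasure (density B ?e) X" if "X \<in> {?O a | a. True}" for X
      using that em[OF fA sA] em[OF fB sB] eq by auto
    show "sets (density A ?e) = sigma_sets ({..<N} \<rightarrow>\<^sub>E UNIV) {?O a | a. True}"
      "sets (density B ?e) = sigma_sets ({..<N} \<rightarrow>\<^sub>E UNIV) {?O a | a. True}"
      by (simp_all add: sA sB sigma_sets_lower_orthants)
    show "range (\<lambda>n. ?O (\<lambda>_. real n)) \<subseteq> {?O a | a. True}"
    proof
      fix X assume "X \<in> range (\<lambda>n. ?O (\<lambda>_. real n))"
      then obtain n where "X = ?O (\<lambda>_. real n)" by (rule rangeE)
      then show "X \<in> {?O a | a. True}" by (intro CollectI exI[of _ "\<lambda>_. real n"]) simp
    qed
    show "(\<Union>n. ?O (\<lambda>_. real n)) = {..<N} \<rightarrow>\<^sub>E UNIV"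
    proof (intro equalityI subsetI)
      fix x :: point assume x: "x \<in> {..<N} \<rightarrow>\<^sub>E UNIV"
      obtain n where n: "(\<Sum>k<N. \<bar>x k\<bar>) \<le> real n" using real_arch_simple by blast
      have "x k \<le> real n" if "k < N" for k
        using member_le_sum[of k "{..<N}" "\<lambda>k. \<bar>x k\<bar>"] that n by force
      then have "x \<in> ?O (\<lambda>_. real n)" using x by (auto simp: PiE_iff)
      then show "x \<in> (\<Union>n. ?O (\<lambda>_. real n))" by blast
    qed (auto simp: PiE_iff)
    \<comment> \<open>The weighted measures may be infinite, but each orthant has finite weighted
      mass, because the integral of ramps it equals up to a constant is a real number.\<close>
    show "emeasure (density A ?e) (?O (\<lambda>_. real i)) \<noteq> \<infinity>" for i
      unfolding em[OF fA sA] by (simp add: ennreal_mult_eq_top_iff)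
  qed
  then have "density (density A ?e) ?i = density (density B ?e) ?i" by simp
  moreover have "density (density M ?e) ?i = M" if [measurable_cong]: "sets M = sets (ell1_borel N)" for M
  proof -
    have "density (density M ?e) ?i = density M (\<lambda>x. ?e x * ?i x)"
      by (rule density_density_eq) measurable
    also have "\<dots> = density M (\<lambda>_. 1)"
      by (simp add: ennreal_mult[symmetric] exp_add[symmetric])
    finally show ?thesis by (simp add: density_1)
  qed
  ultimately show ?thesis using sA sB by simp
qed

text \<open>The hypothesis says that the energy of A - B is zero, spelled out in four mixed energies
  of positive measures. This energy is the integral of the squared difference of the two transforms,
  so they agree almost everywhere.\<close>

lemma measure_eqI_energy:
  assumes fA: "finite_measure A" and fB: "finite_measure B"
    and sA [measurable_cong]: "sets A = sets (ell1_borel N)"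
    and sB [measurable_cong]: "sets B = sets (ell1_borel N)"
    and energy: "(\<integral>x. \<integral>y. exp (- d1 N x y) \<partial>A \<partial>A) - (\<integral>x. \<integral>y. exp (- d1 N x y) \<partial>B \<partial>A)
      = (\<integral>x. \<integral>y. exp (- d1 N x y) \<partial>A \<partial>B) - (\<integral>x. \<integral>y. exp (- d1 N x y) \<partial>B \<partial>B)"
  shows "A = B"
proof -
  let ?L = "ell1_lborel N"
  let ?a = "\<lambda>t. \<integral>x. ramps N x t \<partial>A" and ?b = "\<lambda>t. \<integral>x. ramps N x t \<partial>B"
  have "has_bochner_integral ?L (\<lambda>t. (?a t * ?a t - ?a t * ?b t) - (?b t * ?a t - ?b t * ?b t))
     (((\<integral>x. \<integral>y. exp (- d1 N x y) \<partial>A \<partial>A) - (\<integral>x. \<integral>y. exp (- d1 N x y) \<partial>B \<partial>A))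
      - ((\<integral>x. \<integral>y. exp (- d1 N x y) \<partial>A \<partial>B) - (\<integral>x. \<integral>y. exp (- d1 N x y) \<partial>B \<partial>B)))"
    by (intro has_bochner_integral_diff energy_ramps assms)
  then have *: "has_bochner_integral ?L (\<lambda>t. (?a t - ?b t)\<^sup>2) 0"
    using energy by (simp add: power2_eq_square algebra_simps)
  then have "AE t in ?L. (?a t - ?b t)\<^sup>2 = 0"
    by (subst integral_nonneg_eq_0_iff_AE[symmetric])
      (auto simp: has_bochner_integral_iff)
  then have "AE t in ?L. ?a t = ?b t" by eventually_elim simp
  from integral_ramps_eq[OF fA fB sA sB this] show ?thesis
    by (intro measure_eqI_ramps[OF fA fB sA sB]) auto
qed

subsection \<open>Uniqueness of weight measures\<close>

text \<open>The potential of A - B vanishes on K, while A and B agree off K. Hence its integrals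
  against A and against B see only the common part outside K and coincide, which is the vanishing of
  the energy.\<close>

lemma measure_eqI_kernel:
  assumes fA: "finite_measure A" and fB: "finite_measure B"
    and sA [measurable_cong]: "sets A = sets (ell1_borel N)"
    and sB [measurable_cong]: "sets B = sets (ell1_borel N)"
    and K [measurable]: "K \<in> sets (ell1_borel N)"
    and off: "\<And>S. S \<in> sets (ell1_borel N) \<Longrightarrow> S \<inter> K = {} \<Longrightarrow> measure A S = measure B S"
    and on: "\<And>a. a \<in> K \<Longrightarrow> (\<integral>x. exp (- d1 N x a) \<partial>A) = (\<integral>x. exp (- d1 N x a) \<partial>B)"
  shows "A = B"
proof (rule measure_eqI_energy[OF fA fB sA sB])
  let ?a = "\<lambda>x. \<integral>y. exp (- d1 N x y) \<partial>A" and ?b = "\<lambda>x. \<integral>y. exp (- d1 N x y) \<partial>B"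
  let ?S = "space (ell1_borel N) - K"
  note [measurable] = measurable_integral_kernel[OF fA sA] measurable_integral_kernel[OF fB sB]
  have spA: "space A = space (ell1_borel N)" and spB: "space B = space (ell1_borel N)"
    using sA sB by (auto dest: sets_eq_imp_space_eq)
  have int: "integrable M ?a" "integrable M ?b"
    if "finite_measure M" "sets M = sets (ell1_borel N)" for M
    using that integral_kernel_nonneg_le[OF fA sA] integral_kernel_nonneg_le[OF fB sB]
    by (auto intro!: integrable_bounded simp: measurable_cong_sets[OF that(2) refl])
  have zero: "?a x - ?b x = 0" if "x \<in> K" for x
    using on[OF that] by (simp add: d1_commute)
  have dens: "density A (\<lambda>x. ennreal (indicator ?S x)) = density B (\<lambda>x. ennreal (indicator ?S x))"
  proof (rule measure_eqI)
    fix X assume "X \<in> sets (density A (\<lambda>x. ennreal (indicator ?S x)))"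
    then have X: "X \<in> sets (ell1_borel N)" by (simp add: sA)
    then have "measure A (?S \<inter> X) = measure B (?S \<inter> X)"
      by (intro off) auto
    then have "emeasure A (?S \<inter> X) = emeasure B (?S \<inter> X)"
      using fA fB by (simp add: finite_measure.emeasure_eq_measure)
    then show "emeasure (density A (\<lambda>x. ennreal (indicator ?S x))) X
        = emeasure (density B (\<lambda>x. ennreal (indicator ?S x))) X"
      using X by (simp add: ennreal_indicator emeasure_restricted sA sB)
  qed (simp add: sA sB)
  have restr: "(\<integral>x. ?a x - ?b x \<partial>M) = (\<integral>x. ?a x - ?b x \<partial>density M (\<lambda>x. ennreal (indicator ?S x)))"
    if [measurable_cong]: "sets M = sets (ell1_borel N)" for M
  proof -
    have "space M = space (ell1_borel N)" using that by (rule sets_eq_imp_space_eq)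
    then have "(\<integral>x. ?a x - ?b x \<partial>M) = (\<integral>x. indicator ?S x *\<^sub>R (?a x - ?b x) \<partial>M)"
      using zero by (intro Bochner_Integration.integral_cong) (auto simp: indicator_def)
    also have "\<dots> = (\<integral>x. ?a x - ?b x \<partial>density M (\<lambda>x. ennreal (indicator ?S x)))"
      by (rule integral_density[symmetric]) auto
    finally show ?thesis .
  qed
  have "(\<integral>x. ?a x - ?b x \<partial>A) = (\<integral>x. ?a x - ?b x \<partial>B)"
    using restr[OF sA] restr[OF sB] dens by simp
  then show "(\<integral>x. ?a x \<partial>A) - (\<integral>x. ?b x \<partial>A) = (\<integral>x. ?a x \<partial>B) - (\<integral>x. ?b x \<partial>B)"
    using int[OF fA sA] int[OF fB sB] by simp
qed

lemma is_weight_measure_unique: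
  assumes K: "K \<in> sets (ell1_borel N)"
    and w1: "is_weight_measure N K \<omega>1" and w2: "is_weight_measure N K \<omega>2"
  shows "\<omega>1 = \<omega>2"
proof (cases "K = {}")
  \<comment> \<open>With K empty there is no point whose integral condition would supply a
    decomposition, but then every measurable set is disjoint from K and gets the value 0.\<close>
  case True
  then have "\<omega>1 S = 0" "\<omega>2 S = 0" for S
    using w1 w2 by (cases "S \<in> sets (ell1_borel N)"; auto simp: is_weight_measure_def signed_measure_def)+
  then show ?thesis by auto
next
  case False
  then obtain a0 where a0: "a0 \<in> K" by blast
  let ?M = "ell1_borel N"
  \<comment> \<open>The definition permits a different decomposition for each a in K. The one
    obtained at a0 is shown to serve for all of them.\<close>
  have repr: "\<exists>P Q. finite_measure P \<and> finite_measure Q \<and> sets P = sets ?M \<and> sets Q = sets ?M \<and>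
     (\<forall>S\<in>sets ?M. \<omega> S = measure P S - measure Q S) \<and>
     (\<forall>a\<in>K. (\<integral>x. exp (- d1 N x a) \<partial>P) - (\<integral>x. exp (- d1 N x a) \<partial>Q) = 1)"
    if w: "is_weight_measure N K \<omega>" for \<omega>
  proof -
    have "has_signed_integral ?M \<omega> (\<lambda>x. exp (- d1 N x a0)) 1"
      using w a0 by (auto simp: is_weight_measure_def)
    then obtain P Q where PQ: "finite_measure P" "finite_measure Q" "sets P = sets ?M" "sets Q = sets ?M"
      "\<forall>S\<in>sets ?M. \<omega> S = measure P S - measure Q S"
      unfolding has_signed_integral_def by blast
    have "(\<integral>x. exp (- d1 N x a) \<partial>P) - (\<integral>x. exp (- d1 N x a) \<partial>Q) = 1" if "a \<in> K" for a
    proof -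
      have "has_signed_integral ?M \<omega> (\<lambda>x. exp (- d1 N x a)) 1"
        using w that by (auto simp: is_weight_measure_def)
      then obtain P' Q' where PQ': "finite_measure P'" "finite_measure Q'" "sets P' = sets ?M" "sets Q' = sets ?M"
        "\<forall>S\<in>sets ?M. \<omega> S = measure P' S - measure Q' S"
        and 1: "1 = (\<integral>x. exp (- d1 N x a) \<partial>P') - (\<integral>x. exp (- d1 N x a) \<partial>Q')"
        unfolding has_signed_integral_def by blast
      have "(\<integral>x. exp (- d1 N x a) \<partial>P) + (\<integral>x. exp (- d1 N x a) \<partial>Q')
          = (\<integral>x. exp (- d1 N x a) \<partial>P') + (\<integral>x. exp (- d1 N x a) \<partial>Q)"
      proof (rule integral_add_cong[where M="?M" and b=1])
        show "measure P S + measure Q' S = measure P' S + measure Q S" if "S \<in> sets ?M" for S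
          using PQ(5)[rule_format, OF that] PQ'(5)[rule_format, OF that] by linarith
      qed (use PQ PQ' in \<open>auto simp: d1_nonneg\<close>)
      then show ?thesis using 1 by linarith
    qed
    then show ?thesis using PQ by blast
  qed
  obtain P1 Q1 where 1: "finite_measure P1" "finite_measure Q1" "sets P1 = sets ?M" "sets Q1 = sets ?M"
     "\<And>S. S \<in> sets ?M \<Longrightarrow> \<omega>1 S = measure P1 S - measure Q1 S"
     "\<And>a. a \<in> K \<Longrightarrow> (\<integral>x. exp (- d1 N x a) \<partial>P1) - (\<integral>x. exp (- d1 N x a) \<partial>Q1) = 1"
    using repr[OF w1] by blast
  obtain P2 Q2 where 2: "finite_measure P2" "finite_measure Q2" "sets P2 = sets ?M" "sets Q2 = sets ?M"
     "\<And>S. S \<in> sets ?M \<Longrightarrow> \<omega>2 S = measure P2 S - measure Q2 S"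
     "\<And>a. a \<in> K \<Longrightarrow> (\<integral>x. exp (- d1 N x a) \<partial>P2) - (\<integral>x. exp (- d1 N x a) \<partial>Q2) = 1"
    using repr[OF w2] by blast
  \<comment> \<open>A - B is the difference of the two signed measures, rearranged so that A and B
    are positive.\<close>
  define A where "A = lin_comb_measure UNIV (\<lambda>b::bool. ennreal 1) (\<lambda>b. if b then P1 else Q2) ?M"
  define B where "B = lin_comb_measure UNIV (\<lambda>b::bool. ennreal 1) (\<lambda>b. if b then P2 else Q1) ?M"
  have fin: "finite_measure A" "finite_measure B"
    unfolding A_def B_def by (rule finite_measure_lin_comb; simp add: 1(1-4) 2(1-4))+
  have sets: "sets A = sets ?M" "sets B = sets ?M" by (simp_all add: A_def B_def)
  have mA: "measure A S = measure P1 S + measure Q2 S" and mB: "measure B S = measure P2 S + measure Q1 S"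
    if "S \<in> sets ?M" for S
    unfolding A_def B_def using that 1 2
    by (subst measure_lin_comb; auto simp: UNIV_bool)+
  have "A = B"
  proof (rule measure_eqI_kernel[OF fin sets K])
    fix S assume S: "S \<in> sets ?M" "S \<inter> K = {}"
    then have "\<omega>1 S = 0" "\<omega>2 S = 0" using w1 w2 by (auto simp: is_weight_measure_def)
    then show "measure A S = measure B S"
      using S 1(5)[of S] 2(5)[of S] by (simp add: mA mB)
  next
    fix a assume a: "a \<in> K"
    have "(\<integral>x. exp (- d1 N x a) \<partial>A) = (\<integral>x. exp (- d1 N x a) \<partial>P1) + (\<integral>x. exp (- d1 N x a) \<partial>Q2)"
      unfolding A_def using 1 2 by (subst integral_lin_comb[where b=1]) (auto simp: UNIV_bool d1_nonneg)
    moreover have "(\<integral>x. exp (- d1 N x a) \<partial>B) = (\<integral>x. exp (- d1 N x a) \<partial>P2) + (\<integral>x. exp (- d1 N x a) \<partial>Q1)"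
      unfolding B_def using 1 2 by (subst integral_lin_comb[where b=1]) (auto simp: UNIV_bool d1_nonneg)
    ultimately show "(\<integral>x. exp (- d1 N x a) \<partial>A) = (\<integral>x. exp (- d1 N x a) \<partial>B)"
      using 1(6)[OF a] 2(6)[OF a] by linarith
  qed
  show ?thesis
  proof
    fix S show "\<omega>1 S = \<omega>2 S"
    proof (cases "S \<in> sets ?M")
      case True
      then show ?thesis using mA[OF True] mB[OF True] 1(5)[OF True] 2(5)[OF True] \<open>A = B\<close> by simp
    next
      case False
      then show ?thesis using w1 w2 by (auto simp: is_weight_measure_def signed_measure_def)
    qed
  qed
qed

lemma weight_measure_eq:
  assumes "K \<in> sets (ell1_borel N)" "is_weight_measure N K \<omega>"
  shows "weight_measure N K = \<omega>"
  unfolding weight_measure_def using assms is_weight_measure_unique by blast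

section \<open>Weight measures of intervals\<close>

definition clamp1 :: "real \<Rightarrow> real \<Rightarrow> real \<Rightarrow> real" where
  "clamp1 l h t = max l (min h t)"

text \<open>For l \<le> h the point \<open>clamp1 l h y\<close> is the point of [l, h] nearest to y,
  so this is the distance from y to the interval.\<close>

definition idist :: "real \<Rightarrow> real \<Rightarrow> real \<Rightarrow> real" where
  "idist l h y = \<bar>clamp1 l h y - y\<bar>"

text \<open>
  Pushing half of Lebesgue measure on \<open>[l - 1, h + 1]\<close> forward along the clamping map to \<open>[l, h]\<close> gives
  the weight measure \<open>(\<delta>\<^sub>l + \<lambda> + \<delta>\<^sub>h) / 2\<close> of the interval: the two unit end pieces become the atoms.
\<close>

definition interval_measure1 :: "real \<Rightarrow> real \<Rightarrow> real measure" where
  "interval_measure1 l h = distr (density lborel (\<lambda>t. ennreal (indicator {l - 1..h + 1} t / 2))) borel (clamp1 l h)"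

lemma measurable_clamp1 [measurable]: "clamp1 l h \<in> borel_measurable borel"
  unfolding clamp1_def[abs_def] by measurable

lemma sets_interval_measure1 [simp, measurable_cong]: "sets (interval_measure1 l h) = sets borel"
  by (simp add: interval_measure1_def)

lemma emeasure_interval_measure1:
  assumes X: "X \<in> sets borel"
  shows "emeasure (interval_measure1 l h) X
    = (\<integral>\<^sup>+t. ennreal (indicator {l - 1..h + 1} t / 2) * indicator X (clamp1 l h t) \<partial>lborel)"
proof -
  have "emeasure (interval_measure1 l h) X
     = emeasure (density lborel (\<lambda>t. ennreal (indicator {l - 1..h + 1} t / 2))) (clamp1 l h -` X)"
    unfolding interval_measure1_def using X by (subst emeasure_distr) auto
  also have "\<dots> = (\<integral>\<^sup>+t. ennreal (indicator {l - 1..h + 1} t / 2) * indicator (clamp1 l h -` X) t \<partial>lborel)"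
    using X measurable_sets_borel[OF measurable_clamp1 X] by (subst emeasure_density) auto
  finally show ?thesis by (simp add: indicator_vimage[symmetric] comp_def indicator_def)
qed

text \<open>The mass is half the length h - l + 2 of the enlarged interval. Any X containing the
  image of the clamping map is allowed, so the line and every set between it and [l, h] are covered
  at once.\<close>

lemma emeasure_interval_measure1_full:
  assumes "X \<in> sets borel" "\<And>t. clamp1 l h t \<in> X" "l \<le> h"
  shows "emeasure (interval_measure1 l h) X = ennreal (1 + (h - l) / 2)"
proof -
  have "emeasure (interval_measure1 l h) X
     = (\<integral>\<^sup>+t. ennreal (1/2) * indicator {l - 1..h + 1} t \<partial>lborel)"
    using assms(2) unfolding emeasure_interval_measure1[OF assms(1)]
    by (intro nn_integral_cong) (auto simp: indicator_def)
  also have "\<dots> = ennreal (1/2) * ennreal (h + 1 - (l - 1))"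
    using assms(3) by (subst nn_integral_cmult_indicator) auto
  also have "\<dots> = ennreal (1 + (h - l) / 2)"
    using assms(3) by (subst ennreal_mult[symmetric]) (auto simp: field_simps)
  finally show ?thesis .
qed

text \<open>Has to cover l > h as well: the locale for product measures wants every factor to be
  sigma-finite, including those at indices k \<ge> N, whose bounds are unconstrained.\<close>

lemma finite_measure_interval_measure1: "finite_measure (interval_measure1 l h)"
proof (rule finite_measureI)
  have sp: "space (interval_measure1 l h) = UNIV" by (simp add: interval_measure1_def)
  have "emeasure (interval_measure1 l h) UNIV \<le> (\<integral>\<^sup>+t. indicator {l - 1..h + 1} t \<partial>lborel)"
  proof (subst emeasure_interval_measure1, simp, intro nn_integral_mono)
    fix t
    have "ennreal (indicator {l - 1..h + 1} t / 2) \<le> ennreal (indicator {l - 1..h + 1} t)"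
      by (intro ennreal_leI) simp
    then show "ennreal (indicator {l - 1..h + 1} t / 2) * indicator UNIV (clamp1 l h t) \<le> indicator {l - 1..h + 1} t"
      by (simp add: ennreal_indicator)
  qed
  also have "\<dots> = emeasure lborel {l - 1..h + 1}" by simp
  also have "\<dots> < \<infinity>" using emeasure_lborel_Icc_eq[of "l - 1" "h + 1"] by simp
  finally show "emeasure (interval_measure1 l h) (space (interval_measure1 l h)) \<noteq> \<infinity>"
    unfolding sp by simp
qed

lemma has_integral_exp_dist_left:
  "a \<le> b \<Longrightarrow> b \<le> y \<Longrightarrow> ((\<lambda>t. exp (- \<bar>t - y\<bar>)) has_integral exp (b - y) - exp (a - y)) {a..b}" for a b y :: real
proof -
  assume "a \<le> b" "b \<le> y"
  then have "((\<lambda>t. exp (t - y)) has_integral exp (b - y) - exp (a - y)) {a..b}"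
    by (intro fundamental_theorem_of_calculus)
      (auto intro!: derivative_eq_intros simp flip: has_real_derivative_iff_has_vector_derivative)
  then show ?thesis
    by (rule has_integral_eq[rotated]) (use \<open>b \<le> y\<close> in auto)
qed

lemma has_integral_exp_dist_right:
  "a \<le> b \<Longrightarrow> y \<le> a \<Longrightarrow> ((\<lambda>t. exp (- \<bar>t - y\<bar>)) has_integral exp (y - a) - exp (y - b)) {a..b}" for a b y :: real
proof -
  assume "a \<le> b" "y \<le> a"
  then have "((\<lambda>t. exp (y - t)) has_integral (- exp (y - b)) - (- exp (y - a))) {a..b}"
    by (intro fundamental_theorem_of_calculus)
      (auto intro!: derivative_eq_intros simp flip: has_real_derivative_iff_has_vector_derivative)
  then have "((\<lambda>t. exp (y - t)) has_integral exp (y - a) - exp (y - b)) {a..b}" by simp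
  then show ?thesis
    by (rule has_integral_eq[rotated]) (use \<open>y \<le> a\<close> in auto)
qed

text \<open>On the two unit end pieces the integrand is constant, with values exp (-|l - y|) and exp
  (-|h - y|). These are exactly the terms by which the integral over [l, h] falls short of 2 exp (-
  idist).\<close>

lemma has_integral_exp_clamp1:
  assumes "l \<le> h"
  shows "((\<lambda>t. exp (- \<bar>clamp1 l h t - y\<bar>)) has_integral 2 * exp (- idist l h y)) {l - 1..h + 1}"
proof -
  let ?f = "\<lambda>t. exp (- \<bar>clamp1 l h t - y\<bar>)"
  have 1: "(?f has_integral exp (- \<bar>l - y\<bar>)) {l - 1..l}"
  proof (rule has_integral_eq[rotated])
    show "((\<lambda>_. exp (- \<bar>l - y\<bar>)) has_integral exp (- \<bar>l - y\<bar>)) {l - 1..l}"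
      using has_integral_const_real[of "exp (- \<bar>l - y\<bar>)" "l - 1" l] by simp
  qed (use assms in \<open>auto simp: clamp1_def\<close>)
  have 3: "(?f has_integral exp (- \<bar>h - y\<bar>)) {h..h + 1}"
  proof (rule has_integral_eq[rotated])
    show "((\<lambda>_. exp (- \<bar>h - y\<bar>)) has_integral exp (- \<bar>h - y\<bar>)) {h..h + 1}"
      using has_integral_const_real[of "exp (- \<bar>h - y\<bar>)" "h" "h + 1"] by simp
  qed (use assms in \<open>auto simp: clamp1_def\<close>)
  have 2: "(?f has_integral 2 * exp (- idist l h y) - exp (- \<bar>l - y\<bar>) - exp (- \<bar>h - y\<bar>)) {l..h}"
  proof (rule has_integral_eq[rotated])
    \<comment> \<open>The same closed form holds for y to the left of, to the right of and inside
      the interval; in the last case the integral is split at y.\<close>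
    consider "y \<le> l" | "h \<le> y" | "l \<le> y" "y \<le> h" by linarith
    then show "((\<lambda>t. exp (- \<bar>t - y\<bar>)) has_integral 2 * exp (- idist l h y) - exp (- \<bar>l - y\<bar>) - exp (- \<bar>h - y\<bar>)) {l..h}"
    proof cases
      case 1
      then show ?thesis using has_integral_exp_dist_right[OF assms, of y] assms
        by (simp add: idist_def clamp1_def)
    next
      case 2
      then show ?thesis using has_integral_exp_dist_left[OF assms, of y] assms
        by (simp add: idist_def clamp1_def)
    next
      case 3
      then have "((\<lambda>t. exp (- \<bar>t - y\<bar>)) has_integral (exp (y - y) - exp (l - y)) + (exp (y - y) - exp (y - h))) {l..h}"
        by (intro has_integral_combine[of l y h] has_integral_exp_dist_right has_integral_exp_dist_left) auto
      then show ?thesis using 3 by (simp add: idist_def clamp1_def algebra_simps)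
    qed
  qed (use assms in \<open>auto simp: clamp1_def\<close>)
  have "(?f has_integral exp (- \<bar>l - y\<bar>) + (2 * exp (- idist l h y) - exp (- \<bar>l - y\<bar>) - exp (- \<bar>h - y\<bar>))) {l - 1..h}"
    by (rule has_integral_combine[OF _ _ 1 2]) (use assms in auto)
  from has_integral_combine[OF _ _ this 3] assms show ?thesis by simp
qed

text \<open>The potential is 1 on the interval, which is the weight condition, and outside it decays
  with the distance, which produces the exponentials of the Fragment System.\<close>

lemma integral_interval_measure1:
  assumes "l \<le> h"
  shows "(\<integral>x. exp (- \<bar>x - y\<bar>) \<partial>interval_measure1 l h) = exp (- idist l h y)"
proof -
  let ?f = "\<lambda>t. exp (- \<bar>clamp1 l h t - y\<bar>)"
  have cont: "continuous_on {l - 1..h + 1} ?f"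
    unfolding clamp1_def by (intro continuous_intros)
  have "(\<integral>x. exp (- \<bar>x - y\<bar>) \<partial>interval_measure1 l h)
      = (\<integral>t. (indicator {l - 1..h + 1} t / 2) *\<^sub>R ?f t \<partial>lborel)"
    unfolding interval_measure1_def
    by (subst integral_distr; (subst integral_density)?) auto
  also have "\<dots> = (1/2) * (LINT t:{l - 1..h + 1}|lborel. ?f t)"
    unfolding set_lebesgue_integral_def by (subst integral_mult_right_zero[symmetric]) (simp add: mult_ac)
  also have "(LINT t:{l - 1..h + 1}|lborel. ?f t) = integral {l - 1..h + 1} ?f"
    by (intro set_borel_integral_eq_integral borel_integrable_atLeastAtMost' cont)
  also have "\<dots> = 2 * exp (- idist l h y)"
    by (intro integral_unique has_integral_exp_clamp1 assms)
  finally show ?thesis by simp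
qed

section \<open>Weight measures of boxes, with cubes, faces and points as special cases\<close>

definition rect :: "nat \<Rightarrow> point \<Rightarrow> point \<Rightarrow> point set" where
  "rect N lo hi = (\<Pi>\<^sub>E k\<in>{..<N}. {lo k..hi k})"

definition rect_measure :: "nat \<Rightarrow> point \<Rightarrow> point \<Rightarrow> point measure" where
  "rect_measure N lo hi = PiM {..<N} (\<lambda>k. interval_measure1 (lo k) (hi k))"

lemma rect_sets [measurable]: "rect N lo hi \<in> sets (ell1_borel N)"
  unfolding rect_def ell1_borel_def by (intro sets_PiM_I_finite) auto

lemma sets_rect_measure [simp, measurable_cong]: "sets (rect_measure N lo hi) = sets (ell1_borel N)"
  unfolding rect_measure_def ell1_borel_def by (intro sets_PiM_cong) auto

lemma space_rect_measure: "space (rect_measure N lo hi) = (\<Pi>\<^sub>E k\<in>{..<N}. UNIV)"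
  using sets_eq_imp_space_eq[OF sets_rect_measure] by (simp add: space_ell1_borel)

context
  fixes N :: nat and lo hi :: point
  assumes le: "\<And>k. k < N \<Longrightarrow> lo k \<le> hi k"
begin

interpretation product_sigma_finite "\<lambda>k. interval_measure1 (lo k) (hi k)"
  unfolding product_sigma_finite_def
  using finite_measure_interval_measure1 by (auto simp: finite_measure_def)

text \<open>Each factor is concentrated on its interval, so any product set containing the box
  carries the full mass. It is applied to the whole space, to the box itself and later to a cube
  around a face.\<close>

lemma emeasure_rect_measure_full:
  assumes "\<And>k. k < N \<Longrightarrow> X k \<in> sets borel" "\<And>k. k < N \<Longrightarrow> {lo k..hi k} \<subseteq> X k"
  shows "emeasure (rect_measure N lo hi) (\<Pi>\<^sub>E k\<in>{..<N}. X k) = ennreal (\<Prod>k<N. 1 + (hi k - lo k) / 2)"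
proof -
  have "emeasure (rect_measure N lo hi) (\<Pi>\<^sub>E k\<in>{..<N}. X k) = (\<Prod>k<N. emeasure (interval_measure1 (lo k) (hi k)) (X k))"
    unfolding rect_measure_def using assms(1) by (intro emeasure_PiM) auto
  also have "\<dots> = (\<Prod>k<N. ennreal (1 + (hi k - lo k) / 2))"
  proof (intro prod.cong refl emeasure_interval_measure1_full)
    fix k t assume "k \<in> {..<N}"
    then have k: "k < N" by simp
    have "clamp1 (lo k) (hi k) t \<in> {lo k..hi k}" using le[OF k] by (auto simp: clamp1_def)
    then show "clamp1 (lo k) (hi k) t \<in> X k" using assms(2)[OF k] by blast
  qed (use assms le in auto)
  also have "\<dots> = ennreal (\<Prod>k<N. 1 + (hi k - lo k) / 2)"
    using le by (intro prod_ennreal) (simp add: add_nonneg_nonneg)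
  finally show ?thesis .
qed

lemma finite_measure_rect_measure: "finite_measure (rect_measure N lo hi)"
  by (rule finite_measureI) (simp add: space_rect_measure emeasure_rect_measure_full)

lemma measure_rect_measure_rect: "measure (rect_measure N lo hi) (rect N lo hi) = (\<Prod>k<N. 1 + (hi k - lo k) / 2)"
  unfolding rect_def using le
  by (intro measure_eq_emeasure_eq_ennreal emeasure_rect_measure_full prod_nonneg) (auto simp: add_nonneg_nonneg)

text \<open>Box and whole space have the same finite mass, so the complement of the box is
  null.\<close>

lemma measure_rect_measure_disjoint:
  assumes "S \<in> sets (ell1_borel N)" "S \<inter> rect N lo hi = {}"
  shows "measure (rect_measure N lo hi) S = 0"
proof -
  interpret B: finite_measure "rect_measure N lo hi" by (rule finite_measure_rect_measure)
  have "measure (rect_measure N lo hi) (\<Pi>\<^sub>E k\<in>{..<N}. UNIV) = (\<Prod>k<N. 1 + (hi k - lo k) / 2)"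
    using le by (intro measure_eq_emeasure_eq_ennreal emeasure_rect_measure_full prod_nonneg) (auto simp: add_nonneg_nonneg)
  then have "measure (rect_measure N lo hi) (space (rect_measure N lo hi) - rect N lo hi) = 0"
    by (subst B.finite_measure_compl) (auto simp: measure_rect_measure_rect space_rect_measure)
  moreover have "S \<subseteq> space (rect_measure N lo hi) - rect N lo hi"
    using assms sets.sets_into_space[OF assms(1)] by (auto simp: space_ell1_borel space_rect_measure)
  then have "measure (rect_measure N lo hi) S \<le> measure (rect_measure N lo hi) (space (rect_measure N lo hi) - rect N lo hi)"
    by (intro B.finite_measure_mono) (auto simp: space_rect_measure simp flip: space_ell1_borel)
  ultimately show ?thesis using measure_nonneg[of "rect_measure N lo hi" S] by linarith
qed

lemma integral_rect_measure:
  "(\<integral>x. exp (- d1 N x a) \<partial>rect_measure N lo hi) = exp (- (\<Sum>k<N. idist (lo k) (hi k) (a k)))"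
proof -
  have "(\<integral>x. exp (- d1 N x a) \<partial>rect_measure N lo hi) = (\<integral>x. (\<Prod>k<N. exp (- \<bar>x k - a k\<bar>)) \<partial>rect_measure N lo hi)"
    by (simp add: d1_def sum_negf[symmetric] exp_sum)
  also have "\<dots> = (\<Prod>k<N. \<integral>x. exp (- \<bar>x - a k\<bar>) \<partial>interval_measure1 (lo k) (hi k))"
    unfolding rect_measure_def
    by (intro product_integral_prod finite_measure.integrable_const_bound[OF finite_measure_interval_measure1, where B=1])
      (auto simp: measurable_cong_sets[OF sets_interval_measure1 refl])
  also have "\<dots> = (\<Prod>k<N. exp (- idist (lo k) (hi k) (a k)))"
    using le by (intro prod.cong refl integral_interval_measure1) auto
  finally show ?thesis by (simp add: sum_negf[symmetric] exp_sum)
qed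

lemma weight_measure_rect: "weight_measure N (rect N lo hi) = measure (rect_measure N lo hi)"
proof (rule weight_measure_eq[OF rect_sets])
  \<comment> \<open>A single measure is presented as a combination over a one-element index set, so
    that the results on combinations apply.\<close>
  have signed: "signed_measure (ell1_borel N) (\<lambda>A. \<Sum>i\<in>{()}. 1 * measure (rect_measure N lo hi) A)"
    by (intro signed_measure_lin_comb finite_measure_rect_measure) auto
  have int: "has_signed_integral (ell1_borel N) (\<lambda>A. \<Sum>i\<in>{()}. 1 * measure (rect_measure N lo hi) A)
     (\<lambda>x. exp (- d1 N x a)) (\<Sum>i\<in>{()}. 1 * (\<integral>x. exp (- d1 N x a) \<partial>rect_measure N lo hi))" for a
    by (intro has_signed_integral_lin_comb[where b=1] finite_measure_rect_measure) (auto simp: d1_nonneg)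
  have zero: "(\<Sum>k<N. idist (lo k) (hi k) (a k)) = 0" if "a \<in> rect N lo hi" for a
    using that by (intro sum.neutral) (auto simp: rect_def idist_def clamp1_def PiE_iff)
  have "has_signed_integral (ell1_borel N) (measure (rect_measure N lo hi)) (\<lambda>x. exp (- d1 N x a)) 1"
    if "a \<in> rect N lo hi" for a
    using int[of a] integral_rect_measure[of a] zero[OF that] by simp
  then show "is_weight_measure N (rect N lo hi) (measure (rect_measure N lo hi))"
    unfolding is_weight_measure_def
    using signed by (simp add: measure_rect_measure_disjoint)
qed

text \<open>Clamping y coordinatewise yields a point of the box that minimises every summand of the
  distance separately, so the infimum is attained there.\<close>

lemma d1_set_rect: "d1_set N (rect N lo hi) y = (\<Sum>k<N. idist (lo k) (hi k) (y k))"
  unfolding d1_set_def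
proof (rule cInf_eq_minimum)
  define c where "c = (\<lambda>k\<in>{..<N}. clamp1 (lo k) (hi k) (y k))"
  have "c \<in> rect N lo hi" using le by (auto simp: c_def rect_def clamp1_def PiE_iff)
  moreover have "(\<Sum>k<N. idist (lo k) (hi k) (y k)) = d1 N c y"
    unfolding d1_def by (intro sum.cong refl) (simp add: c_def idist_def)
  ultimately show "(\<Sum>k<N. idist (lo k) (hi k) (y k)) \<in> (\<lambda>a. d1 N a y) ` rect N lo hi" by blast
  fix z assume "z \<in> (\<lambda>a. d1 N a y) ` rect N lo hi"
  then obtain a where a: "a \<in> rect N lo hi" "z = d1 N a y" by blast
  have "idist (lo k) (hi k) (y k) \<le> \<bar>a k - y k\<bar>" if "k < N" for k
  proof -
    have "lo k \<le> a k" "a k \<le> hi k" using a(1) that by (auto simp: rect_def PiE_iff)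
    then show ?thesis by (auto simp: idist_def clamp1_def max_def min_def abs_if)
  qed
  then show "(\<Sum>k<N. idist (lo k) (hi k) (y k)) \<le> z"
    unfolding a(2) d1_def by (intro sum_mono) auto
qed

end

subsection \<open>Nonsingularity of similarity matrices\<close>

lemma rect_point: "p \<in> ell1 N \<Longrightarrow> rect N p p = {p}"
  by (simp add: rect_def ell1_def PiE_iff PiE_singleton)

lemma clamp1_point [simp]: "clamp1 a a t = a"
  by (simp add: clamp1_def)

text \<open>A degenerate box has mass 1 and a null complement, so its measure is the Dirac measure
  at p. This brings finite sets under the uniqueness argument for measures.\<close>

lemma measure_rect_measure_point:
  assumes "p \<in> ell1 N" "S \<in> sets (ell1_borel N)"
  shows "measure (rect_measure N p p) S = indicator S p"
proof -
  interpret finite_measure "rect_measure N p p" by (rule finite_measure_rect_measure) simp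
  have rect: "rect N p p = {p}"
    by (rule rect_point) fact
  have null: "measure (rect_measure N p p) T = 0" if "T \<in> sets (ell1_borel N)" "p \<notin> T" for T
    using measure_rect_measure_disjoint[of N p p T] that by (auto simp: rect)
  have p: "{p} \<in> sets (ell1_borel N)" using rect_sets[of N p p] by (simp add: rect)
  have "measure (rect_measure N p p) {p} = 1"
    using measure_rect_measure_rect[of N p p] by (simp add: rect)
  moreover have "measure (rect_measure N p p) S = measure (rect_measure N p p) (S - {p}) + measure (rect_measure N p p) {p}" if "p \<in> S"
    using finite_measure_Union[of "S - {p}" "{p}"] that assms(2) p by (auto simp: insert_absorb)
  ultimately show ?thesis
    using null[of S] null[of "S - {p}"] assms(2) p by (auto simp: indicator_def)
qed

lemma integral_rect_measure_point:
  "(\<integral>x. exp (- d1 N x a) \<partial>rect_measure N p p) = exp (- d1 N p a)"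
  using integral_rect_measure[of N p p a] by (simp add: idist_def d1_def[of N p a])

text \<open>The positive and the negative parts of c are placed as point masses on F. The two
  measures have equal potentials on F and no mass elsewhere, so they coincide; comparing them on {p}
  gives c p = 0.\<close>

lemma exp_d1_independent:
  assumes F: "finite F" "F \<subseteq> ell1 N"
    and zero: "\<And>q. q \<in> F \<Longrightarrow> (\<Sum>p\<in>F. exp (- d1 N p q) * c p) = 0"
    and p: "p \<in> F"
  shows "c p = 0"
proof -
  let ?M = "ell1_borel N"
  define A where "A = lin_comb_measure F (\<lambda>p. ennreal (max (c p) 0)) (\<lambda>p. rect_measure N p p) ?M"
  define B where "B = lin_comb_measure F (\<lambda>p. ennreal (max (- c p) 0)) (\<lambda>p. rect_measure N p p) ?M"
  have c: "max x 0 - max (- x) 0 = x" for x :: real by (auto simp: max_def)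
  have fin: "finite_measure A" "finite_measure B"
    unfolding A_def B_def using F(1)
    by (auto intro!: finite_measure_lin_comb finite_measure_rect_measure)
  have sets: "sets A = sets ?M" "sets B = sets ?M" by (simp_all add: A_def B_def)
  have meas_lin: "measure (lin_comb_measure F (\<lambda>p. ennreal (d p)) (\<lambda>p. rect_measure N p p) ?M) S
      = (\<Sum>p\<in>F. d p * indicator S p)" if "S \<in> sets ?M" "\<And>p. 0 \<le> d p" for S d
  proof (subst measure_lin_comb)
    show "(\<Sum>i\<in>F. d i * measure (rect_measure N i i) S) = (\<Sum>p\<in>F. d p * indicator S p)"
      using F that(1) by (intro sum.cong refl) (auto simp: measure_rect_measure_point)
  qed (use F that in \<open>auto intro: finite_measure_rect_measure\<close>)
  have int_lin: "(\<integral>x. exp (- d1 N x a) \<partial>lin_comb_measure F (\<lambda>p. ennreal (d p)) (\<lambda>p. rect_measure N p p) ?M)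
      = (\<Sum>p\<in>F. d p * exp (- d1 N p a))" if "\<And>p. 0 \<le> d p" for a d
  proof (subst integral_lin_comb[where b=1])
    show "(\<Sum>i\<in>F. d i * (\<integral>x. exp (- d1 N x a) \<partial>rect_measure N i i)) = (\<Sum>p\<in>F. d p * exp (- d1 N p a))"
      by (simp add: integral_rect_measure_point)
  qed (use F that in \<open>auto intro: finite_measure_rect_measure simp: d1_nonneg\<close>)
  have meas: "measure A S = (\<Sum>p\<in>F. max (c p) 0 * indicator S p)"
       "measure B S = (\<Sum>p\<in>F. max (- c p) 0 * indicator S p)" if "S \<in> sets ?M" for S
    unfolding A_def B_def using that by (simp_all add: meas_lin)
  have int: "(\<integral>x. exp (- d1 N x a) \<partial>A) = (\<Sum>p\<in>F. max (c p) 0 * exp (- d1 N p a))"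
       "(\<integral>x. exp (- d1 N x a) \<partial>B) = (\<Sum>p\<in>F. max (- c p) 0 * exp (- d1 N p a))" for a
    unfolding A_def B_def by (simp_all add: int_lin)
  have single: "{p} \<in> sets ?M" if "p \<in> F" for p
    by (metis rect_sets rect_point F(2) subsetD that)
  have "A = B"
  proof (rule measure_eqI_kernel[OF fin sets])
    have "(\<Union>p\<in>F. {p}) \<in> sets ?M" using F(1) single by (intro sets.finite_UN) auto
    then show "F \<in> sets ?M" by simp
    show "measure A S = measure B S" if "S \<in> sets ?M" "S \<inter> F = {}" for S
    proof -
      have "indicator S p = (0::real)" if "p \<in> F" for p using that \<open>S \<inter> F = {}\<close> by (auto simp: indicator_def)
      then show ?thesis unfolding meas[OF that(1)] by simp
    qed
    fix a assume "a \<in> F"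
    then have "(\<Sum>p\<in>F. max (c p) 0 * exp (- d1 N p a)) - (\<Sum>p\<in>F. max (- c p) 0 * exp (- d1 N p a)) = 0"
      using zero[of a] by (simp add: sum_subtractf[symmetric] left_diff_distrib[symmetric] c mult.commute)
    then show "(\<integral>x. exp (- d1 N x a) \<partial>A) = (\<integral>x. exp (- d1 N x a) \<partial>B)"
      unfolding int by simp
  qed
  then have "(\<Sum>q\<in>F. max (c q) 0 * indicator {p} q) = (\<Sum>q\<in>F. max (- c q) 0 * (indicator {p} q :: real))"
    using meas[OF single[OF p]] by simp
  moreover have "(\<Sum>q\<in>F. g q * indicator {p} q) = g p" for g :: "point \<Rightarrow> real"
    by (subst sum.remove[OF F(1) p]) (auto simp: indicator_def intro!: sum.neutral)
  ultimately have "max (c p) 0 = max (- c p) 0" by simp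
  then show ?thesis using c[of "c p"] by simp
qed

lemma weighting_eqI:
  assumes F: "finite F" "F \<subseteq> ell1 N"
    and eq: "\<And>q. q \<in> F \<Longrightarrow> (\<Sum>p\<in>F. exp (- d1 N p q) * w p) = 1" and p: "p \<in> F"
  shows "weighting N F p = w p"
proof -
  have "weighting N F = restrict w F"
    unfolding weighting_def
  proof (rule the_equality)
    show "restrict w F \<in> extensional F \<and> (\<forall>p\<in>F. (\<Sum>q\<in>F. exp (- d1 N p q) * restrict w F q) = 1)"
      using eq by (auto simp: d1_commute cong: sum.cong)
    fix v assume v: "v \<in> extensional F \<and> (\<forall>p\<in>F. (\<Sum>q\<in>F. exp (- d1 N p q) * v q) = 1)"
    have "v q - w q = 0" if "q \<in> F" for q
    proof (rule exp_d1_independent[OF F _ that, where c="\<lambda>q. v q - w q"])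
      fix a assume a: "a \<in> F"
      then have "(\<Sum>q\<in>F. exp (- d1 N q a) * v q) = 1" using v by (subst d1_commute) auto
      then show "(\<Sum>p\<in>F. exp (- d1 N p a) * (v p - w p)) = 0"
        using eq[OF a] by (simp add: right_diff_distrib sum_subtractf)
    qed
    then show "v = restrict w F" using v by (auto intro!: extensionalityI[of v F])
  qed
  then show ?thesis using p by simp
qed

subsection \<open>Linear systems over a finite index set\<close>

lemma continuous_on_det:
  fixes f :: "'a::topological_space \<Rightarrow> nat \<Rightarrow> nat \<Rightarrow> real"
  assumes "\<And>i j. i < n \<Longrightarrow> j < n \<Longrightarrow> continuous_on S (\<lambda>r. f r i j)"
  shows "continuous_on S (\<lambda>r. Determinant.det (mat n n (\<lambda>(i, j). f r i j)))"
proof -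
  have p: "p i < n" if "p permutes {0..<n}" "i < n" for p i
    using permutes_in_image[OF that(1), of i] that(2) by simp
  have "Determinant.det (mat n n (\<lambda>(i, j). f r i j))
     = (\<Sum>p\<in>{p. p permutes {0..<n}}. signof p * (\<Prod>i = 0..<n. f r i (p i)))" for r
    by (subst det_def'[of _ n]) (auto intro!: sum.cong prod.cong simp: p)
  then show ?thesis
    by (simp, intro continuous_intros) (auto intro!: assms simp: p)
qed

text \<open>Repeats the enumeration in \<open>FS_mat\<close> for an arbitrary index set, so that
  systems can be stated as sums over I.\<close>

definition index_mat :: "'i set \<Rightarrow> ('i \<Rightarrow> 'i \<Rightarrow> real) \<Rightarrow> real mat" where
  "index_mat I a = mat (card I) (card I) (\<lambda>(i, j). a (from_nat_into I i) (from_nat_into I j))"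

lemma index_mat_carrier [simp]: "index_mat I a \<in> carrier_mat (card I) (card I)"
  by (simp add: index_mat_def)

context
  fixes I :: "'i set"
  assumes I: "finite I"
begin

lemma bij_enum: "bij_betw (from_nat_into I) {0..<card I} I"
  using bij_betw_from_nat_into_finite[OF I] by (simp add: lessThan_atLeast0)

lemma enum_surj: "i \<in> I \<Longrightarrow> \<exists>k<card I. i = from_nat_into I k"
  using bij_enum by (force simp: bij_betw_def)

lemma enum_in: "k < card I \<Longrightarrow> from_nat_into I k \<in> I"
  using bij_enum by (force simp: bij_betw_def)

lemma index_mat_mult_vec:
  assumes "k < card I"
  shows "(index_mat I a *\<^sub>v Matrix.vec (card I) (\<lambda>j. x (from_nat_into I j))) $ k
    = (\<Sum>j\<in>I. a (from_nat_into I k) j * x j)"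
  using assms sum.reindex_bij_betw[OF bij_enum, of "\<lambda>j. a (from_nat_into I k) j * x j"]
  by (simp add: index_mat_def scalar_prod_def)

lemma solution_exists:
  assumes "Determinant.det (index_mat I a) \<noteq> 0"
  shows "\<exists>x. \<forall>i\<in>I. (\<Sum>j\<in>I. a i j * x j) = b i"
proof -
  let ?n = "card I" let ?e = "from_nat_into I"
  have "index_mat I a \<in> Units (ring_mat TYPE(real) ?n ())"
    by (rule det_non_zero_imp_unit[OF index_mat_carrier assms])
  then obtain B where B: "B \<in> carrier_mat ?n ?n" "index_mat I a * B = 1\<^sub>m ?n"
    unfolding Units_def ring_mat_def by auto
  let ?b = "Matrix.vec ?n (\<lambda>i. b (?e i))"
  define v where "v = B *\<^sub>v ?b"
  have v: "v \<in> carrier_vec ?n" using B(1) by (simp add: v_def)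
  have "index_mat I a *\<^sub>v v = (index_mat I a * B) *\<^sub>v ?b"
    unfolding v_def using B(1) by (intro assoc_mult_mat_vec[OF index_mat_carrier, symmetric]) auto
  then have Av: "index_mat I a *\<^sub>v v = ?b" using B(2) by simp
  define x where "x = (\<lambda>j. v $ (the_inv_into {0..<?n} ?e j))"
  have "Matrix.vec ?n (\<lambda>j. x (?e j)) = v"
    using v bij_enum by (intro eq_vecI) (auto simp: x_def the_inv_into_f_f bij_betw_def)
  then have "\<forall>k<?n. (\<Sum>j\<in>I. a (?e k) j * x j) = b (?e k)"
    using index_mat_mult_vec[of _ a x] Av by simp
  then show ?thesis using enum_surj by metis
qed

text \<open>Replacing column k of the matrix by its product with x multiplies the determinant by the
  k-th entry of x. The explicit quotient yields both uniqueness and continuous dependence on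
  parameters.\<close>

lemma solution_cramer:
  assumes det: "Determinant.det (index_mat I a) \<noteq> 0"
    and sol: "\<And>i. i \<in> I \<Longrightarrow> (\<Sum>j\<in>I. a i j * x j) = b i" and k: "k < card I"
  shows "x (from_nat_into I k)
    = Determinant.det (mat (card I) (card I) (\<lambda>(i, j). if j = k then b (from_nat_into I i)
          else a (from_nat_into I i) (from_nat_into I j))) / Determinant.det (index_mat I a)"
proof -
  let ?x = "Matrix.vec (card I) (\<lambda>j. x (from_nat_into I j))"
  have "replace_col (index_mat I a) (index_mat I a *\<^sub>v ?x) k
    = mat (card I) (card I) (\<lambda>(i, j). if j = k then b (from_nat_into I i)
          else a (from_nat_into I i) (from_nat_into I j))"
  proof (rule eq_matI)
    fix i j assume ij: "i < dim_row (mat (card I) (card I) (\<lambda>(i, j). if j = k then b (from_nat_into I i)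
          else a (from_nat_into I i) (from_nat_into I j)))"
      "j < dim_col (mat (card I) (card I) (\<lambda>(i, j). if j = k then b (from_nat_into I i)
          else a (from_nat_into I i) (from_nat_into I j)))"
    then have "(index_mat I a *\<^sub>v ?x) $ i = b (from_nat_into I i)"
      using index_mat_mult_vec[of i a x] sol[OF enum_in, of i] by simp
    then show "replace_col (index_mat I a) (index_mat I a *\<^sub>v ?x) k $$ (i, j)
      = mat (card I) (card I) (\<lambda>(i, j). if j = k then b (from_nat_into I i)
          else a (from_nat_into I i) (from_nat_into I j)) $$ (i, j)"
      using ij by (simp add: replace_col_def index_mat_def)
  qed (simp_all add: replace_col_def index_mat_def)
  moreover have "Determinant.det (replace_col (index_mat I a) (index_mat I a *\<^sub>v ?x) k) = ?x $ k * Determinant.det (index_mat I a)"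
    by (rule cramer_lemma_mat[OF index_mat_carrier _ k]) simp
  ultimately show ?thesis using det k by simp
qed

lemma solution_unique:
  assumes det: "Determinant.det (index_mat I a) \<noteq> 0"
    and "\<And>i. i \<in> I \<Longrightarrow> (\<Sum>j\<in>I. a i j * x j) = b i" "\<And>i. i \<in> I \<Longrightarrow> (\<Sum>j\<in>I. a i j * y j) = b i" "i \<in> I"
  shows "x i = y i"
proof -
  obtain k where "k < card I" "i = from_nat_into I k" using enum_surj assms(4) by blast
  then show ?thesis
    using solution_cramer[OF det assms(2), of k] solution_cramer[OF det assms(3), of k] by simp
qed

lemma det_index_mat_nonzeroI:
  assumes "\<And>x. (\<And>i. i \<in> I \<Longrightarrow> (\<Sum>j\<in>I. a i j * x j) = 0) \<Longrightarrow> \<forall>i\<in>I. x i = 0"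
  shows "Determinant.det (index_mat I a) \<noteq> 0"
proof
  let ?n = "card I" let ?e = "from_nat_into I"
  assume "Determinant.det (index_mat I a) = 0"
  then obtain v where v: "v \<in> carrier_vec ?n" "v \<noteq> 0\<^sub>v ?n" "index_mat I a *\<^sub>v v = 0\<^sub>v ?n"
    using det_0_iff_vec_prod_zero_field[OF index_mat_carrier] by blast
  define x where "x = (\<lambda>j. v $ (the_inv_into {0..<?n} ?e j))"
  have vx: "Matrix.vec ?n (\<lambda>j. x (?e j)) = v"
    using v bij_enum by (intro eq_vecI) (auto simp: x_def the_inv_into_f_f bij_betw_def)
  then have "\<forall>k<?n. (\<Sum>j\<in>I. a (?e k) j * x j) = 0"
    using index_mat_mult_vec[of _ a x] v by simp
  then have "\<forall>i\<in>I. x i = 0" using assms enum_surj by metis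
  then have "v = 0\<^sub>v ?n"
    unfolding vx[symmetric] by (intro eq_vecI) (auto simp: enum_in)
  then show False using v(2) by simp
qed

lemma continuous_on_solution:
  fixes a :: "'r::topological_space \<Rightarrow> 'i \<Rightarrow> 'i \<Rightarrow> real"
  assumes a: "\<And>i j. i \<in> I \<Longrightarrow> j \<in> I \<Longrightarrow> continuous_on S (\<lambda>r. a r i j)"
    and b: "\<And>i. i \<in> I \<Longrightarrow> continuous_on S (\<lambda>r. b r i)"
    and det: "\<And>r. r \<in> S \<Longrightarrow> Determinant.det (index_mat I (a r)) \<noteq> 0"
    and sol: "\<And>r i. r \<in> S \<Longrightarrow> i \<in> I \<Longrightarrow> (\<Sum>j\<in>I. a r i j * x r j) = b r i"
    and i: "i \<in> I"
  shows "continuous_on S (\<lambda>r. x r i)"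
proof -
  obtain k where k: "k < card I" "i = from_nat_into I k" using enum_surj i by blast
  let ?num = "\<lambda>r. Determinant.det (mat (card I) (card I) (\<lambda>(i, j). if j = k then b r (from_nat_into I i)
          else a r (from_nat_into I i) (from_nat_into I j)))"
  have "continuous_on S (\<lambda>r. ?num r / Determinant.det (index_mat I (a r)))"
  proof (intro continuous_on_divide ballI det)
    show "continuous_on S ?num"
    proof (rule continuous_on_det)
      fix i j assume "i < card I" "j < card I"
      then show "continuous_on S (\<lambda>r. if j = k then b r (from_nat_into I i) else a r (from_nat_into I i) (from_nat_into I j))"
        by (cases "j = k") (auto intro!: a b enum_in)
    qed
    show "continuous_on S (\<lambda>r. Determinant.det (index_mat I (a r)))"
      unfolding index_mat_def by (intro continuous_on_det a enum_in)
  qed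
  then show ?thesis
    by (rule continuous_on_eq) (simp add: k(2) solution_cramer[OF det sol k(1)])
qed

end

subsection \<open>Fragment systems\<close>

definition zero_dir :: "nat \<Rightarrow> point" where
  "zero_dir N = (\<lambda>k\<in>{..<N}. 0)"

definition Sgn :: "nat \<Rightarrow> point set" where
  "Sgn N = {..<N} \<rightarrow>\<^sub>E {-1, 0, 1}"

text \<open>The sign vector of p + g s - q for all small g > 0, with g eliminated: s is consulted
  only in coordinates where p and q agree.\<close>

definition direction :: "nat \<Rightarrow> point \<Rightarrow> point \<times> point \<Rightarrow> point" where
  "direction N q = (\<lambda>(p, s). \<lambda>k\<in>{..<N}. if p k = q k then s k else sgn (p k - q k))"

lemma Dir_eq: "Dir N = Sgn N - {zero_dir N}"
proof -
  have "({..<N} \<rightarrow>\<^sub>E {0}) = {zero_dir N}" by (simp add: PiE_singleton zero_dir_def restrict_def)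
  then show ?thesis by (simp add: Dir_def Sgn_def)
qed

lemma zero_dir_in_Sgn: "zero_dir N \<in> Sgn N"
  by (simp add: zero_dir_def Sgn_def)

lemma finite_Sgn: "finite (Sgn N)"
  unfolding Sgn_def by (intro finite_PiE) auto

lemma Sgn_cases: "u \<in> Sgn N \<Longrightarrow> k < N \<Longrightarrow> u k = -1 \<or> u k = 0 \<or> u k = 1"
  unfolding Sgn_def by (auto dest: PiE_mem)

lemma direction_in_Sgn: "s \<in> Sgn N \<Longrightarrow> direction N q (p, s) \<in> Sgn N"
  unfolding direction_def Sgn_def by (auto simp: sgn_if PiE_iff)

lemma direction_eq_iff:
  assumes "u \<in> Sgn N"
  shows "direction N q (p, s) = u \<longleftrightarrow> (\<forall>k<N. (if p k = q k then s k else sgn (p k - q k)) = u k)"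
proof
  assume "\<forall>k<N. (if p k = q k then s k else sgn (p k - q k)) = u k"
  then show "direction N q (p, s) = u"
    using assms by (intro extensionalityI[of _ "{..<N}"]) (auto simp: direction_def Sgn_def PiE_iff)
qed (auto simp: direction_def)

text \<open>Used for the one direction that has no equation in the Fragment System: seen from q,
  only the cube at q itself has direction 0.\<close>

lemma direction_eq_zero_iff:
  assumes "p \<in> ell1 N" "q \<in> ell1 N" "s \<in> Sgn N"
  shows "direction N q (p, s) = zero_dir N \<longleftrightarrow> p = q \<and> s = zero_dir N"
proof
  assume eq: "direction N q (p, s) = zero_dir N"
  then have *: "(if p k = q k then s k else sgn (p k - q k)) = 0" if "k < N" for k
    using that unfolding direction_eq_iff[OF zero_dir_in_Sgn] by (simp add: zero_dir_def)
  then have k: "p k = q k" if "k < N" for k using *[OF that] by (auto simp: sgn_if split: if_splits)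
  then have "p = q" using assms(1,2) by (intro extensionalityI[of p "{..<N}"]) (auto simp: ell1_def PiE_iff)
  moreover have "s = zero_dir N"
    using * k assms(3) by (intro extensionalityI[of s "{..<N}"]) (auto simp: Sgn_def PiE_iff zero_dir_def)
  ultimately show "p = q \<and> s = zero_dir N" by simp
qed (auto simp: direction_def zero_dir_def)

section \<open>Faces as boxes and their potentials\<close>

lemma face_eq_rect: "face N p s r = rect N (\<lambda>k. p k + r * Lside (s k)) (\<lambda>k. p k + r * Rside (s k))"
  by (simp add: face_def rect_def)

lemma cube_eq_face: "cube N p r = face N p (zero_dir N) r"
  unfolding cube_def face_def by (intro PiE_cong) (simp add: zero_dir_def Lside_def Rside_def)

lemma Lside_le_Rside: "Lside t \<le> Rside t"
  by (simp add: Lside_def Rside_def)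

lemma face_subset_cube: "0 \<le> r \<Longrightarrow> face N p s r \<subseteq> cube N p r"
  unfolding face_def cube_def
  by (intro PiE_mono) (auto simp: Lside_def Rside_def)

abbreviation face_measure :: "nat \<Rightarrow> point \<Rightarrow> point \<Rightarrow> real \<Rightarrow> point measure" where
  "face_measure N p s r \<equiv> rect_measure N (\<lambda>k. p k + r * Lside (s k)) (\<lambda>k. p k + r * Rside (s k))"

definition face_potential :: "nat \<Rightarrow> real \<Rightarrow> point \<times> point \<Rightarrow> point \<Rightarrow> real" where
  "face_potential N r = (\<lambda>(p, s) y. exp (- d1_set N (face N p s r) y))"

lemma face_bounds: "0 \<le> r \<Longrightarrow> p k + r * Lside (s k) \<le> p k + r * Rside (s k)"
  by (simp add: Lside_le_Rside mult_left_mono)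

lemma d1_set_face:
  "0 \<le> r \<Longrightarrow> d1_set N (face N p s r) y = (\<Sum>k<N. idist (p k + r * Lside (s k)) (p k + r * Rside (s k)) (y k))"
  unfolding face_eq_rect by (rule d1_set_rect) (rule face_bounds)

lemma integral_face_measure:
  "0 \<le> r \<Longrightarrow> (\<integral>x. exp (- d1 N x a) \<partial>face_measure N p s r) = face_potential N r (p, s) a"
  by (subst integral_rect_measure) (simp_all only: face_potential_def d1_set_face face_bounds prod.case)

lemma idist_below: "y \<le> l \<Longrightarrow> l \<le> h \<Longrightarrow> idist l h y = l - y"
  and idist_above: "h \<le> y \<Longrightarrow> l \<le> h \<Longrightarrow> idist l h y = y - h"
  and idist_inside: "l \<le> y \<Longrightarrow> y \<le> h \<Longrightarrow> idist l h y = 0"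
  by (auto simp: idist_def clamp1_def)

section \<open>The Fragment System as an identity of potentials on the cubes\<close>

locale fragment_system =
  fixes N :: nat and F :: "point set"
  assumes finite_F: "finite F" and F_nonempty: "F \<noteq> {}" and F_sub: "F \<subseteq> ell1 N"
begin

lemma F_differ: "p \<in> F \<Longrightarrow> q \<in> F \<Longrightarrow> p \<noteq> q \<Longrightarrow> \<exists>k<N. p k \<noteq> q k"
  using F_sub extensionalityI[of p "{..<N}" q] by (force simp: ell1_def PiE_iff)

lemma finite_gaps: "finite ({\<bar>p k - q k\<bar> | p q k. p \<in> F \<and> q \<in> F \<and> k < N} - {0})"
proof -
  have "{\<bar>p k - q k\<bar> | p q k. p \<in> F \<and> q \<in> F \<and> k < N} = (\<lambda>(p, q, k). \<bar>p k - q k\<bar>) ` (F \<times> F \<times> {..<N})"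
    by force
  then show ?thesis using finite_F by simp
qed

text \<open>A coordinate in which p and q differ excludes the infinite branch of \<open>chg\<close>,
  and then r is less than half the smallest nonzero gap.\<close>

lemma gap:
  assumes "ereal r < chg N F" "p \<in> F" "q \<in> F" "k < N" "p k \<noteq> q k"
  shows "2 * r < \<bar>p k - q k\<bar>"
proof -
  have "p \<noteq> q" using assms by auto
  then have "\<not> card F \<le> 1" using assms finite_F by (auto simp: card_le_Suc0_iff_eq)
  then have "2 * r < Min ({\<bar>p k - q k\<bar> | p q k. p \<in> F \<and> q \<in> F \<and> k < N} - {0})"
    using assms(1) by (simp add: chg_def)
  also have "\<dots> \<le> \<bar>p k - q k\<bar>"
    using assms by (intro Min_le finite_gaps) auto
  finally show ?thesis .
qed

lemma chg_pos: "0 < chg N F"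
proof (cases "card F \<le> 1")
  case False
  let ?G = "{\<bar>p k - q k\<bar> | p q k. p \<in> F \<and> q \<in> F \<and> k < N} - {0}"
  from False obtain p q where pq: "p \<in> F" "q \<in> F" "p \<noteq> q"
    using finite_F by (auto simp: card_le_Suc0_iff_eq)
  with F_differ obtain k where "k < N" "p k \<noteq> q k" by blast
  then have "\<bar>p k - q k\<bar> \<in> ?G" using pq by auto
  then have "?G \<noteq> {}" by (metis empty_iff)
  then have "Min ?G \<in> ?G" by (intro Min_in finite_gaps)
  then have "0 < Min ?G" by auto
  then show ?thesis using False by (simp add: chg_def)
qed (simp add: chg_def)

text \<open>Where p k and q k differ, their distance exceeds 2 g, so adding g * s k cannot change
  the sign; where they agree, the sign is s k. This removes the arbitrary choice of g.\<close>

lemma dotted_fragment_eq: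
  assumes q: "q \<in> F" and u: "u \<in> Sgn N"
  shows "dotted_fragment N F q u = {ps \<in> F \<times> Dir N. direction N q ps = u}"
proof -
  define g where "g = (SOME g::real. 0 < g \<and> ereal g < chg N F)"
  have "\<exists>g. 0 < g \<and> ereal g < chg N F"
    using ereal_dense2[OF chg_pos] by (auto simp: zero_ereal_def)
  then have g: "0 < g" "ereal g < chg N F"
    unfolding g_def using someI_ex[of "\<lambda>g. 0 < g \<and> ereal g < chg N F"] by auto
  have sgn: "sgn (p k + g * s k - q k) = (if p k = q k then s k else sgn (p k - q k))"
    if "p \<in> F" "s \<in> Dir N" "k < N" for p s k
  proof -
    have "s k = -1 \<or> s k = 0 \<or> s k = 1" using that Sgn_cases[of s N k] by (auto simp: Dir_eq)
    moreover have "2 * g < \<bar>p k - q k\<bar>" if "p k \<noteq> q k"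
      using gap[OF g(2) \<open>p \<in> F\<close> q \<open>k < N\<close>] that by simp
    ultimately show ?thesis using g(1) by (cases "p k = q k") (auto simp: sgn_if abs_if split: if_splits)
  qed
  have "(p, s) \<in> dotted_fragment N F q u \<longleftrightarrow> (p, s) \<in> {ps \<in> F \<times> Dir N. direction N q ps = u}" for p s
    unfolding dotted_fragment_def Let_def g_def[symmetric]
    by (simp add: direction_eq_iff[OF u] sgn cong: conj_cong split del: if_split)
  then show ?thesis by auto
qed

lemma fragment_eq:
  assumes q: "q \<in> F" and u: "u \<in> Dir N"
  shows "fragment N F q u = {p \<in> F. direction N q (p, zero_dir N) = u}"
proof -
  have "u \<in> Sgn N" using u by (simp add: Dir_eq)
  moreover have "(if p k = q k then zero_dir N k else sgn (p k - q k)) = sgn (p k - q k)" if "k < N" for p k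
    using that by (simp add: zero_dir_def)
  ultimately show ?thesis by (simp add: fragment_def direction_eq_iff cong: conj_cong)
qed

text \<open>Brings both sides of the Fragment System into one sum over
  \<open>F \<times> Sgn N\<close>: cubes count 1, proper faces the negated unknown. With
  \<open>alpha\<close> for x these are the coefficients in \<open>omega_cubes\<close>.\<close>

definition coef :: "(point \<times> point \<Rightarrow> real) \<Rightarrow> point \<times> point \<Rightarrow> real" where
  "coef x = (\<lambda>(p, s). if s = zero_dir N then 1 else - x (p, s))"

lemma sum_F_Sgn:
  fixes h :: "point \<times> point \<Rightarrow> real"
  shows "(\<Sum>ps | ps \<in> F \<times> Sgn N \<and> P ps. h ps)
    = (\<Sum>p | p \<in> F \<and> P (p, zero_dir N). h (p, zero_dir N)) + (\<Sum>ps | ps \<in> F \<times> Dir N \<and> P ps. h ps)"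
proof -
  have "{ps \<in> F \<times> Sgn N. P ps} = {ps \<in> F \<times> {zero_dir N}. P ps} \<union> {ps \<in> F \<times> Dir N. P ps}"
    using zero_dir_in_Sgn by (auto simp: Dir_eq)
  then have "(\<Sum>ps | ps \<in> F \<times> Sgn N \<and> P ps. h ps)
     = (\<Sum>ps\<in>{ps \<in> F \<times> {zero_dir N}. P ps}. h ps) + (\<Sum>ps | ps \<in> F \<times> Dir N \<and> P ps. h ps)"
    using finite_F finite_Sgn by (simp, subst sum.union_disjoint) (auto simp: Dir_eq)
  also have "(\<Sum>ps\<in>{ps \<in> F \<times> {zero_dir N}. P ps}. h ps) = (\<Sum>p | p \<in> F \<and> P (p, zero_dir N). h (p, zero_dir N))"
    by (intro sum.reindex_bij_witness[where i="\<lambda>p. (p, zero_dir N)" and j=fst]) auto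
  finally show ?thesis .
qed

lemma sum_coef:
  assumes u: "u \<in> Sgn N" and q: "q \<in> F"
  shows "(\<Sum>ps | ps \<in> F \<times> Sgn N \<and> direction N q ps = u. coef x ps * face_potential N r ps y)
   = (\<Sum>p | p \<in> F \<and> direction N q (p, zero_dir N) = u. exp (- d1_set N (cube N p r) y))
     - (\<Sum>(p, s)\<in>dotted_fragment N F q u. x (p, s) * exp (- d1_set N (face N p s r) y))"
proof -
  have "(\<Sum>ps | ps \<in> F \<times> Dir N \<and> direction N q ps = u. coef x ps * face_potential N r ps y)
    = - (\<Sum>(p, s)\<in>dotted_fragment N F q u. x (p, s) * exp (- d1_set N (face N p s r) y))"
    unfolding dotted_fragment_eq[OF q u] sum_negf[symmetric]
  proof (intro sum.cong refl)
    fix ps assume "ps \<in> {ps \<in> F \<times> Dir N. direction N q ps = u}"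
    then have "snd ps \<noteq> zero_dir N" by (auto simp: Dir_eq)
    then show "coef x ps * face_potential N r ps y = - (case ps of (p, s) \<Rightarrow> x (p, s) * exp (- d1_set N (face N p s r) y))"
      by (cases ps) (simp add: coef_def face_potential_def)
  qed
  then show ?thesis
    by (simp add: sum_F_Sgn coef_def face_potential_def cube_eq_face)
qed

text \<open>For nonzero u this is the equation (q, u) with everything on one side. For u = 0 the
  only term is the cube at q, evaluated at its centre, where the potential is 1.\<close>

lemma fs_solution_sum:
  assumes sol: "fs_solution N F r x" and r: "0 \<le> r" and q: "q \<in> F" and u: "u \<in> Sgn N"
  shows "(\<Sum>ps | ps \<in> F \<times> Sgn N \<and> direction N q ps = u. coef x ps * face_potential N r ps (shift N q r u))
    = (if u = zero_dir N then 1 else 0)"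
proof (cases "u = zero_dir N")
  case False
  then have "u \<in> Dir N" using u by (simp add: Dir_eq)
  then show ?thesis
    unfolding sum_coef[OF u q] using sol q False
    by (auto simp: fs_solution_def fragment_eq)
next
  case True
  have "{ps \<in> F \<times> Sgn N. direction N q ps = u} = {(q, zero_dir N)}"
    using direction_eq_zero_iff[of _ N q] q F_sub zero_dir_in_Sgn unfolding True by blast
  moreover have "d1_set N (face N q (zero_dir N) r) (shift N q r (zero_dir N)) = 0"
    using r by (subst d1_set_face) (auto simp: idist_def clamp1_def zero_dir_def shift_def Lside_def Rside_def)
  ultimately show ?thesis
    using True by (simp add: coef_def face_potential_def)
qed

text \<open>In coordinate k the face lies above the cube at q for u k = 1, below it for u k = -1,
  and equals its side for u k = 0, touching allowed. So the distance from a is affine in a k with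
  slope - u k, and the change from the corner value depends on u and a but not on the face. The
  bound r < \<open>chg\<close> keeps faces at other coordinates beyond the cube.\<close>

lemma idist_face_shift:
  assumes r: "0 \<le> r" "ereal r < chg N F" and p: "p \<in> F" and q: "q \<in> F" and s: "s \<in> Sgn N" and u: "u \<in> Sgn N"
    and dir: "direction N q (p, s) = u" and a: "a \<in> cube N q r" and k: "k < N"
  shows "idist (p k + r * Lside (s k)) (p k + r * Rside (s k)) (a k)
    = idist (p k + r * Lside (s k)) (p k + r * Rside (s k)) (shift N q r u k) + (r * \<bar>u k\<bar> - u k * (a k - q k))"
proof -
  have ak: "q k - r \<le> a k" "a k \<le> q k + r" using a k by (auto simp: cube_def PiE_iff)
  have uk: "u k = (if p k = q k then s k else sgn (p k - q k))"
    using dir k by (auto simp: direction_eq_iff[OF u])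
  have le: "p k + r * Lside (s k) \<le> p k + r * Rside (s k)" by (rule face_bounds[OF r(1)])
  have sh: "shift N q r u k = q k + r * u k" using k by (simp add: shift_def)
  have side: "r * Lside (s k) \<ge> - r" "r * Rside (s k) \<le> r"
    using r(1) by (auto simp: Lside_def Rside_def)
  consider "p k = q k" | "q k < p k" | "p k < q k" by linarith
  then show ?thesis
  proof cases
    case 1
    then consider "u k = -1" "s k = -1" | "u k = 0" "s k = 0" | "u k = 1" "s k = 1"
      using Sgn_cases[OF s k] uk by auto
    then show ?thesis unfolding sh using 1 ak r(1)
      by cases (simp_all add: idist_below idist_above idist_inside Lside_def Rside_def)
  next
    case 2
    then have "2 * r < p k - q k" "u k = 1" using gap[OF r(2) p q k] uk by auto
    then show ?thesis unfolding sh using side ak by (simp add: idist_below[OF _ le])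
  next
    case 3
    then have "2 * r < q k - p k" "u k = -1" using gap[OF r(2) p q k] uk by auto
    then show ?thesis unfolding sh using side ak by (simp add: idist_above[OF _ le])
  qed
qed

lemma face_potential_shift:
  assumes "0 \<le> r" "ereal r < chg N F" "p \<in> F" "q \<in> F" "s \<in> Sgn N" "u \<in> Sgn N"
    "direction N q (p, s) = u" "a \<in> cube N q r"
  shows "face_potential N r (p, s) a
    = face_potential N r (p, s) (shift N q r u) * exp (- (\<Sum>k<N. r * \<bar>u k\<bar> - u k * (a k - q k)))"
  using assms(1)
  by (simp add: face_potential_def d1_set_face idist_face_shift[OF assms] sum.distrib exp_add[symmetric])

lemma potential_eq_1:
  assumes sol: "fs_solution N F r x" and r: "0 \<le> r" "ereal r < chg N F" and q: "q \<in> F" and a: "a \<in> cube N q r"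
  shows "(\<Sum>ps\<in>F \<times> Sgn N. coef x ps * face_potential N r ps a) = 1"
proof -
  \<comment> \<open>The common factor from the corner q + r u to a. It is 1 for u = 0, the only
    direction whose corner sum is nonzero.\<close>
  let ?f = "\<lambda>u. exp (- (\<Sum>k<N. r * \<bar>u k\<bar> - u k * (a k - q k)))"
  have "(\<Sum>ps\<in>F \<times> Sgn N. coef x ps * face_potential N r ps a)
    = (\<Sum>u\<in>Sgn N. \<Sum>ps | ps \<in> F \<times> Sgn N \<and> direction N q ps = u. coef x ps * face_potential N r ps a)"
    using finite_F finite_Sgn by (intro sum.group[symmetric]) (auto intro: direction_in_Sgn)
  also have "\<dots> = (\<Sum>u\<in>Sgn N. ?f u * (\<Sum>ps | ps \<in> F \<times> Sgn N \<and> direction N q ps = u. coef x ps * face_potential N r ps (shift N q r u)))"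
  proof (intro sum.cong refl)
    fix u assume u: "u \<in> Sgn N"
    have "coef x ps * face_potential N r ps a = ?f u * (coef x ps * face_potential N r ps (shift N q r u))"
      if "ps \<in> {ps. ps \<in> F \<times> Sgn N \<and> direction N q ps = u}" for ps
    proof -
      obtain p s where ps: "ps = (p, s)" by (cases ps)
      then have "p \<in> F" "s \<in> Sgn N" "direction N q (p, s) = u" using that by auto
      then show ?thesis unfolding ps using face_potential_shift[OF r _ q _ u _ a, of p s] by simp
    qed
    then show "(\<Sum>ps | ps \<in> F \<times> Sgn N \<and> direction N q ps = u. coef x ps * face_potential N r ps a)
       = ?f u * (\<Sum>ps | ps \<in> F \<times> Sgn N \<and> direction N q ps = u. coef x ps * face_potential N r ps (shift N q r u))"
      unfolding sum_distrib_left by (intro sum.cong refl)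
  qed
  also have "\<dots> = (\<Sum>u\<in>Sgn N. ?f u * (if u = zero_dir N then 1 else 0))"
    by (intro sum.cong refl) (simp add: fs_solution_sum[OF sol r(1) q])
  also have "\<dots> = ?f (zero_dir N)"
    using finite_Sgn zero_dir_in_Sgn by (subst sum.remove[of _ "zero_dir N"]) (auto intro!: sum.neutral)
  also have "\<dots> = 1" by (simp add: zero_dir_def)
  finally show ?thesis .
qed

end

subsection \<open>Nonsingularity at zero and limits\<close>

context fragment_system
begin

section \<open>The Fragment System as a linear system with continuous coefficients\<close>

lemma finite_index: "finite (F \<times> Dir N)"
  using finite_F finite_Sgn by (simp add: Dir_eq)

definition fs_rhs :: "real \<Rightarrow> point \<times> point \<Rightarrow> real" where
  "fs_rhs r = (\<lambda>(q, u). \<Sum>p \<in> fragment N F q u. exp (- d1_set N (cube N p r) (shift N q r u)))"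

lemma sum_fs_coeff:
  assumes "q \<in> F" "u \<in> Dir N"
  shows "(\<Sum>ps\<in>F \<times> Dir N. fs_coeff N F r (q, u) ps * x ps)
    = (\<Sum>(p, s) \<in> dotted_fragment N F q u. x (p, s) * exp (- d1_set N (face N p s r) (shift N q r u)))"
proof -
  have sub: "dotted_fragment N F q u \<subseteq> F \<times> Dir N"
    using assms by (subst dotted_fragment_eq) (auto simp: Dir_eq)
  have "(\<Sum>(p, s) \<in> dotted_fragment N F q u. x (p, s) * exp (- d1_set N (face N p s r) (shift N q r u)))
    = (\<Sum>ps\<in>dotted_fragment N F q u. fs_coeff N F r (q, u) ps * x ps)"
    by (intro sum.cong refl) (auto simp: fs_coeff_def)
  also have "\<dots> = (\<Sum>ps\<in>F \<times> Dir N. fs_coeff N F r (q, u) ps * x ps)"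
    by (intro sum.mono_neutral_left finite_index sub) (auto simp: fs_coeff_def)
  finally show ?thesis ..
qed

lemma fs_solution_iff:
  "fs_solution N F r x \<longleftrightarrow> (\<forall>i\<in>F \<times> Dir N. (\<Sum>j\<in>F \<times> Dir N. fs_coeff N F r i j * x j) = fs_rhs r i)"
  unfolding fs_solution_def by (intro ball_cong refl) (auto simp: sum_fs_coeff fs_rhs_def)

lemma FS_mat_eq: "FS_mat N F r = index_mat (F \<times> Dir N) (fs_coeff N F r)"
  by (simp add: FS_mat_def index_mat_def Let_def)

lemma alpha_solution:
  assumes "r \<in> S_set N F"
  shows "fs_solution N F r (alpha N F r)"
proof -
  have det: "Determinant.det (index_mat (F \<times> Dir N) (fs_coeff N F r)) \<noteq> 0"
    using assms by (simp add: S_set_def FS_mat_eq)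
  obtain x where x: "\<forall>i\<in>F \<times> Dir N. (\<Sum>j\<in>F \<times> Dir N. fs_coeff N F r i j * x j) = fs_rhs r i"
    using solution_exists[OF finite_index det] by blast
  have "\<exists>!x. x \<in> extensional (F \<times> Dir N) \<and> fs_solution N F r x"
  proof (rule ex1I)
    show "restrict x (F \<times> Dir N) \<in> extensional (F \<times> Dir N) \<and> fs_solution N F r (restrict x (F \<times> Dir N))"
      using x by (simp add: fs_solution_iff)
    fix y assume y: "y \<in> extensional (F \<times> Dir N) \<and> fs_solution N F r y"
    have "y i = x i" if "i \<in> F \<times> Dir N" for i
    proof (rule solution_unique[OF finite_index det _ _ that])
      show "(\<Sum>j\<in>F \<times> Dir N. fs_coeff N F r k j * y j) = fs_rhs r k" if "k \<in> F \<times> Dir N" for k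
        using y that unfolding fs_solution_iff by blast
      show "(\<Sum>j\<in>F \<times> Dir N. fs_coeff N F r k j * x j) = fs_rhs r k" if "k \<in> F \<times> Dir N" for k
        using x that by blast
    qed
    then show "y = restrict x (F \<times> Dir N)"
      using y by (intro extensionalityI[of y "F \<times> Dir N"]) auto
  qed
  from theI'[OF this] show ?thesis unfolding alpha_def by blast
qed

text \<open>For r \<ge> 0 the distance is a sum of expressions built from affine functions of r by
  max, min and absolute value.\<close>

lemma continuous_on_face_potential:
  "continuous_on {0..} (\<lambda>r. exp (- d1_set N (face N p s r) (shift N q r u)))"
proof (rule continuous_on_eq)
  show "continuous_on {0..} (\<lambda>r. exp (- (\<Sum>k<N. idist (p k + r * Lside (s k)) (p k + r * Rside (s k)) (q k + r * u k))))"
    unfolding idist_def clamp1_def by (intro continuous_intros)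
qed (simp add: d1_set_face shift_def)

lemma continuous_on_fs_coeff: "S \<subseteq> {0..} \<Longrightarrow> continuous_on S (\<lambda>r. fs_coeff N F r i j)"
  using continuous_on_subset[OF continuous_on_face_potential]
  by (cases i; cases j; cases "j \<in> dotted_fragment N F (fst i) (snd i)") (simp_all add: fs_coeff_def)

lemma continuous_on_fs_rhs: "S \<subseteq> {0..} \<Longrightarrow> continuous_on S (\<lambda>r. fs_rhs r i)"
  using continuous_on_subset[OF continuous_on_face_potential]
  by (cases i) (auto simp: fs_rhs_def cube_eq_face intro!: continuous_on_sum)

lemma continuous_on_alpha:
  assumes "p \<in> F" "s \<in> Dir N"
  shows "continuous_on (S_set N F) (\<lambda>r. alpha N F r (p, s))"
proof (rule continuous_on_solution[OF finite_index, where a="fs_coeff N F" and b=fs_rhs])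
  have S: "S_set N F \<subseteq> {0..}" by (auto simp: S_set_def)
  show "continuous_on (S_set N F) (\<lambda>r. fs_coeff N F r i j)" "continuous_on (S_set N F) (\<lambda>r. fs_rhs r i)" for i j
    using S by (rule continuous_on_fs_coeff, rule continuous_on_fs_rhs)
  show "Determinant.det (index_mat (F \<times> Dir N) (fs_coeff N F r)) \<noteq> 0" if "r \<in> S_set N F" for r
    using that by (simp add: S_set_def FS_mat_eq)
  show "(\<Sum>j\<in>F \<times> Dir N. fs_coeff N F r i j * alpha N F r j) = fs_rhs r i"
    if "r \<in> S_set N F" "i \<in> F \<times> Dir N" for r i
    using alpha_solution[OF that(1)] that(2) unfolding fs_solution_iff by blast
qed (use assms in simp)

section \<open>Regularity of the system at and near r = 0\<close>

lemma face_potential_0: "exp (- d1_set N (face N p s 0) y) = exp (- d1 N p y)"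
  by (subst d1_set_face) (auto simp: idist_def d1_def)

text \<open>The equations are summed over all u that agree with t on K. A point p agreeing with q on
  K then contributes its sum over all s with s = t on K. Any other p contributes either nothing or
  such a sum for a proper subset of K, which is zero by induction. What remains is a homogeneous
  similarity system.\<close>

lemma marginal_zero:
  assumes hom: "\<And>q u. q \<in> F \<Longrightarrow> u \<in> Sgn N \<Longrightarrow>
      (\<Sum>ps | ps \<in> F \<times> Sgn N \<and> direction N q ps = u. y ps * exp (- d1 N (fst ps) q)) = 0"
    and "K \<subseteq> {..<N}" "p \<in> F"
  shows "(\<Sum>s | s \<in> Sgn N \<and> (\<forall>k\<in>K. s k = t k). y (p, s)) = 0"
  using assms(2,3)
proof (induction "card K" arbitrary: K p rule: less_induct)
  case less
  define Y where "Y = (\<lambda>K p. \<Sum>s | s \<in> Sgn N \<and> (\<forall>k\<in>K. s k = t k). y (p, s))"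
  have finK: "finite K" using less.prems finite_subset by blast
  have eq: "(\<Sum>p | p \<in> F \<and> (\<forall>k\<in>K. p k = q k). exp (- d1 N p q) * Y K p) = 0" if q: "q \<in> F" for q
  proof -
    let ?e = "\<lambda>ps. y ps * exp (- d1 N (fst ps) q)"
    let ?S = "{ps \<in> F \<times> Sgn N. \<forall>k\<in>K. direction N q ps k = t k}"
    let ?T = "{u \<in> Sgn N. \<forall>k\<in>K. u k = t k}"
    have "0 = (\<Sum>u\<in>?T. \<Sum>ps | ps \<in> F \<times> Sgn N \<and> direction N q ps = u. ?e ps)"
      using hom[OF q] by (simp add: sum.neutral)
    also have "\<dots> = (\<Sum>u\<in>?T. \<Sum>ps | ps \<in> ?S \<and> direction N q ps = u. ?e ps)"
      by (intro sum.cong refl) auto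
    also have "\<dots> = (\<Sum>ps\<in>?S. ?e ps)"
      using finite_F finite_Sgn by (intro sum.group) (auto intro: direction_in_Sgn)
    also have "?S = (SIGMA p:F. {s \<in> Sgn N. \<forall>k\<in>K. direction N q (p, s) k = t k})" by auto
    also have "(\<Sum>ps\<in>\<dots>. ?e ps) = (\<Sum>p\<in>F. \<Sum>s | s \<in> Sgn N \<and> (\<forall>k\<in>K. direction N q (p, s) k = t k). y (p, s) * exp (- d1 N p q))"
      using finite_F finite_Sgn by (subst sum.Sigma) (auto simp: case_prod_unfold)
    also have "\<dots> = (\<Sum>p\<in>F. if \<forall>k\<in>K. p k = q k then exp (- d1 N p q) * Y K p else 0)"
    proof (intro sum.cong refl)
      fix p assume p: "p \<in> F"
      have dir: "direction N q (p, s) k = (if p k = q k then s k else sgn (p k - q k))" if "k \<in> K" for s k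
        using that less.prems by (auto simp: direction_def)
      show "(\<Sum>s | s \<in> Sgn N \<and> (\<forall>k\<in>K. direction N q (p, s) k = t k). y (p, s) * exp (- d1 N p q))
        = (if \<forall>k\<in>K. p k = q k then exp (- d1 N p q) * Y K p else 0)"
      proof (cases "\<forall>k\<in>K. p k = q k")
        case True
        then have "{s. s \<in> Sgn N \<and> (\<forall>k\<in>K. direction N q (p, s) k = t k)} = {s. s \<in> Sgn N \<and> (\<forall>k\<in>K. s k = t k)}"
          by (simp add: dir)
        then show ?thesis using True by (simp add: Y_def sum_distrib_left mult.commute)
      next
        case False
        \<comment> \<open>Outside K' the direction is decided by p and q alone, so it either
          contradicts t or leaves s restricted on K' only.\<close>
        define K' where "K' = {k \<in> K. p k = q k}"
        have "K' \<subset> K" using False by (auto simp: K'_def)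
        then have "card K' < card K" "K' \<subseteq> {..<N}"
          using finK less.prems by (auto intro: psubset_card_mono)
        then have 0: "(\<Sum>s | s \<in> Sgn N \<and> (\<forall>k\<in>K'. s k = t k). y (p, s)) = 0"
          using less.hyps p by blast
        have "(\<Sum>s | s \<in> Sgn N \<and> (\<forall>k\<in>K. direction N q (p, s) k = t k). y (p, s)) = 0"
        proof (cases "\<forall>k\<in>K - K'. sgn (p k - q k) = t k")
          case True
          then have "{s. s \<in> Sgn N \<and> (\<forall>k\<in>K. direction N q (p, s) k = t k)} = {s. s \<in> Sgn N \<and> (\<forall>k\<in>K'. s k = t k)}"
            by (auto simp: dir K'_def)
          then show ?thesis using 0 by simp
        next
          case False
          then obtain k where "k \<in> K" "p k \<noteq> q k" "sgn (p k - q k) \<noteq> t k" by (auto simp: K'_def)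
          then have "{s. s \<in> Sgn N \<and> (\<forall>k\<in>K. direction N q (p, s) k = t k)} = {}" by (auto simp: dir)
          then show ?thesis by (simp only: sum.empty)
        qed
        then have "(\<Sum>s | s \<in> Sgn N \<and> (\<forall>k\<in>K. direction N q (p, s) k = t k). y (p, s) * exp (- d1 N p q)) = 0"
          by (simp add: sum_distrib_right[symmetric])
        then show ?thesis using False by (simp only: if_False)
      qed
    qed
    also have "\<dots> = (\<Sum>p | p \<in> F \<and> (\<forall>k\<in>K. p k = q k). exp (- d1 N p q) * Y K p)"
      using finite_F by (rule sum.inter_filter[symmetric])
    finally show ?thesis ..
  qed
  \<comment> \<open>For every q in \<open>?F0\<close> the remaining equation involves exactly the
    points of \<open>?F0\<close>, so these equations form a square similarity system.\<close>
  let ?F0 = "{p' \<in> F. \<forall>k\<in>K. p' k = p k}"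
  have "Y K p = 0"
  proof (rule exp_d1_independent[where F="?F0" and N=N and c="Y K"])
    fix q assume q: "q \<in> ?F0"
    then have "{p'. p' \<in> F \<and> (\<forall>k\<in>K. p' k = q k)} = ?F0" by auto
    then show "(\<Sum>p\<in>?F0. exp (- d1 N p q) * Y K p) = 0" using eq[of q] q by simp
  qed (use finite_F F_sub less.prems in auto)
  then show ?case by (simp add: Y_def)
qed

text \<open>A kernel vector, extended by 0 to the zero direction, satisfies the homogeneous
  equations for every u including 0. With K the set of all coordinates the sum in
  \<open>marginal_zero\<close> has the single term y (p, s).\<close>

lemma det_FS_mat_0: "Determinant.det (FS_mat N F 0) \<noteq> 0"
  unfolding FS_mat_eq
proof (rule det_index_mat_nonzeroI[OF finite_index])
  fix x :: "point \<times> point \<Rightarrow> real"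
  assume x: "\<And>i. i \<in> F \<times> Dir N \<Longrightarrow> (\<Sum>j\<in>F \<times> Dir N. fs_coeff N F 0 i j * x j) = 0"
  define y where "y = (\<lambda>ps. if snd ps = zero_dir N then 0 else x ps)"
  have hom: "(\<Sum>ps | ps \<in> F \<times> Sgn N \<and> direction N q ps = u. y ps * exp (- d1 N (fst ps) q)) = 0"
    if q: "q \<in> F" and u: "u \<in> Sgn N" for q u
  proof (cases "u = zero_dir N")
    case True
    have "y ps * exp (- d1 N (fst ps) q) = 0"
      if "ps \<in> {ps. ps \<in> F \<times> Sgn N \<and> direction N q ps = u}" for ps
    proof -
      obtain p s where ps: "ps = (p, s)" by (cases ps)
      then have "p \<in> F" "s \<in> Sgn N" "direction N q (p, s) = zero_dir N" using that True by auto
      then have "s = zero_dir N" using direction_eq_zero_iff[of p N q s] F_sub q by auto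
      then show ?thesis by (simp add: y_def ps)
    qed
    then show ?thesis by (intro sum.neutral ballI)
  next
    case False
    then have uD: "u \<in> Dir N" using u by (simp add: Dir_eq)
    have "(\<Sum>ps | ps \<in> F \<times> Sgn N \<and> direction N q ps = u. y ps * exp (- d1 N (fst ps) q))
      = (\<Sum>ps | ps \<in> F \<times> Dir N \<and> direction N q ps = u. y ps * exp (- d1 N (fst ps) q))"
      by (simp add: sum_F_Sgn y_def)
    also have "\<dots> = (\<Sum>(p, s) \<in> dotted_fragment N F q u. x (p, s) * exp (- d1_set N (face N p s 0) (shift N q 0 u)))"
      unfolding dotted_fragment_eq[OF q u]
    proof (intro sum.cong refl)
      fix ps assume "ps \<in> {ps \<in> F \<times> Dir N. direction N q ps = u}"
      then have "snd ps \<noteq> zero_dir N" by (auto simp: Dir_eq)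
      moreover have "d1 N p (shift N q 0 u) = d1 N p q" for p
        unfolding d1_def by (intro sum.cong refl) (simp add: shift_def)
      ultimately show "y ps * exp (- d1 N (fst ps) q) = (case ps of (p, s) \<Rightarrow> x (p, s) * exp (- d1_set N (face N p s 0) (shift N q 0 u)))"
        by (cases ps) (simp add: y_def face_potential_0 del: exp_inj_iff)
    qed
    also have "\<dots> = 0" using x[of "(q, u)"] q uD by (simp add: sum_fs_coeff)
    finally show ?thesis .
  qed
  show "\<forall>i\<in>F \<times> Dir N. x i = 0"
  proof
    fix i assume "i \<in> F \<times> Dir N"
    then obtain p s where i: "i = (p, s)" "p \<in> F" "s \<in> Sgn N" "s \<noteq> zero_dir N" by (auto simp: Dir_eq)
    have "{s'. s' \<in> Sgn N \<and> (\<forall>k\<in>{..<N}. s' k = s k)} = {s}"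
      using i(3) by (auto simp: Sgn_def PiE_iff intro!: extensionalityI[where A="{..<N}"])
    then have "y (p, s) = 0" using marginal_zero[OF hom subset_refl i(2), of s] by simp
    then show "x i = 0" using i by (simp add: y_def)
  qed
qed

lemma S_set_contains_interval: "\<exists>\<rho>::real. 0 < \<rho> \<and> ereal \<rho> \<le> chg N F \<and> {0..<\<rho>} \<subseteq> S_set N F"
proof -
  let ?d = "\<lambda>r. Determinant.det (FS_mat N F r)"
  have "continuous_on {0..} ?d"
    unfolding FS_mat_eq index_mat_def by (intro continuous_on_det continuous_on_fs_coeff) auto
  then have "(?d \<longlongrightarrow> ?d 0) (at 0 within {0..})" by (simp add: continuous_on_def)
  then have "eventually (\<lambda>r. ?d r \<noteq> 0) (at 0 within {0..})"
    using det_FS_mat_0 by (rule tendsto_imp_eventually_ne)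
  then obtain \<delta> where \<delta>: "0 < \<delta>" "\<And>r. 0 \<le> r \<Longrightarrow> r \<noteq> 0 \<Longrightarrow> dist r 0 < \<delta> \<Longrightarrow> ?d r \<noteq> 0"
    unfolding eventually_at by auto
  \<comment> \<open>A real number below \<open>chg N F\<close>, which may be infinite while the
    required bound is real.\<close>
  obtain g where g: "0 < g" "ereal g < chg N F"
    using ereal_dense2[OF chg_pos] by (auto simp: zero_ereal_def)
  have "{0..<min \<delta> g} \<subseteq> S_set N F"
  proof
    fix r assume r: "r \<in> {0..<min \<delta> g}"
    then have "ereal r < ereal g" by simp
    then have "ereal r < chg N F" using g(2) by (rule less_trans)
    moreover have "?d r \<noteq> 0" using \<delta>(2)[of r] det_FS_mat_0 r by (cases "r = 0") (auto simp: dist_real_def)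
    ultimately show "r \<in> S_set N F" using r by (simp add: S_set_def)
  qed
  moreover have "ereal (min \<delta> g) \<le> chg N F"
    using g(2) by (metis ereal_less_eq(3) less_imp_le min.cobounded2 order_trans)
  ultimately show ?thesis using \<delta>(1) g(1) by (intro exI[of _ "min \<delta> g"]) auto
qed

section \<open>The signed measure on the union of cubes and its limit\<close>

lemma omega_cubes_eq:
  assumes r: "0 \<le> r"
  shows "omega_cubes N F r A = (\<Sum>ps\<in>F \<times> Sgn N. coef (alpha N F r) ps * measure (face_measure N (fst ps) (snd ps) r) A)"
proof -
  have wm: "weight_measure N (face N p s r) = measure (face_measure N p s r)" for p s
    unfolding face_eq_rect by (intro weight_measure_rect face_bounds r)
  have "(\<Sum>ps\<in>F \<times> Dir N. coef (alpha N F r) ps * measure (face_measure N (fst ps) (snd ps) r) A)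
    = - (\<Sum>(p, s)\<in>F \<times> Dir N. alpha N F r (p, s) * measure (face_measure N p s r) A)"
    unfolding sum_negf[symmetric]
  proof (intro sum.cong refl)
    fix ps assume "ps \<in> F \<times> Dir N"
    then have "snd ps \<noteq> zero_dir N" by (auto simp: Dir_eq)
    then show "coef (alpha N F r) ps * measure (face_measure N (fst ps) (snd ps) r) A
      = - (case ps of (p, s) \<Rightarrow> alpha N F r (p, s) * measure (face_measure N p s r) A)"
      by (cases ps) (simp add: coef_def)
  qed
  then show ?thesis
    using sum_F_Sgn[where P="\<lambda>_. True" and h="\<lambda>ps. coef (alpha N F r) ps * measure (face_measure N (fst ps) (snd ps) r) A"]
    unfolding omega_cubes_def cube_eq_face wm by (simp add: coef_def)
qed

lemma finite_face_measure: "0 \<le> r \<Longrightarrow> finite_measure (face_measure N p s r)"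
  by (intro finite_measure_rect_measure face_bounds)

text \<open>Faces lie inside their cubes, which settles the support. Integrating the kernel against
  a face measure gives its potential, so the integral condition becomes
  \<open>potential_eq_1\<close>.\<close>

lemma is_weight_measure_omega_cubes:
  assumes r: "r \<in> S_set N F"
  shows "is_weight_measure N (cubes N F r) (omega_cubes N F r)"
proof -
  have r': "0 \<le> r" "ereal r < chg N F" using r by (auto simp: S_set_def)
  let ?w = "\<lambda>A. \<Sum>ps\<in>F \<times> Sgn N. coef (alpha N F r) ps * measure (face_measure N (fst ps) (snd ps) r) A"
  have "omega_cubes N F r = ?w" using omega_cubes_eq[OF r'(1)] by blast
  moreover have "signed_measure (ell1_borel N) ?w"
    by (intro signed_measure_lin_comb finite_face_measure r') simp
  moreover have "?w A = 0" if A: "A \<in> sets (ell1_borel N)" "A \<inter> cubes N F r = {}" for A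
  proof (intro sum.neutral ballI)
    fix ps assume ps: "ps \<in> F \<times> Sgn N"
    have "cube N (fst ps) r \<subseteq> cubes N F r"
      unfolding cubes_def using ps by (intro UN_upper) auto
    with face_subset_cube[OF r'(1)] have "face N (fst ps) (snd ps) r \<subseteq> cubes N F r"
      by (rule order_trans)
    then have "A \<inter> face N (fst ps) (snd ps) r = {}" using A(2) by blast
    then have "measure (face_measure N (fst ps) (snd ps) r) A = 0"
      using A(1) r'(1) by (intro measure_rect_measure_disjoint face_bounds) (auto simp: face_eq_rect)
    then show "coef (alpha N F r) ps * measure (face_measure N (fst ps) (snd ps) r) A = 0" by simp
  qed
  moreover have "has_signed_integral (ell1_borel N) ?w (\<lambda>x. exp (- d1 N x a)) 1" if a: "a \<in> cubes N F r" for a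
  proof -
    obtain q where q: "q \<in> F" "a \<in> cube N q r"
      using a unfolding cubes_def by blast
    have "has_signed_integral (ell1_borel N) ?w (\<lambda>x. exp (- d1 N x a))
      (\<Sum>ps\<in>F \<times> Sgn N. coef (alpha N F r) ps * (\<integral>x. exp (- d1 N x a) \<partial>face_measure N (fst ps) (snd ps) r))"
      using finite_F finite_Sgn r'
      by (intro has_signed_integral_lin_comb[where b=1] finite_face_measure) (auto simp: d1_nonneg)
    also have "(\<Sum>ps\<in>F \<times> Sgn N. coef (alpha N F r) ps * (\<integral>x. exp (- d1 N x a) \<partial>face_measure N (fst ps) (snd ps) r)) = 1"
      using potential_eq_1[OF alpha_solution[OF r] r' q] by (simp add: integral_face_measure[OF r'(1)])
    finally show ?thesis .
  qed
  ultimately show ?thesis unfolding is_weight_measure_def by simp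
qed

lemma cube_sets: "cube N p r \<in> sets (ell1_borel N)"
  unfolding cube_eq_face face_eq_rect by (rule rect_sets)

lemma cube_disjoint:
  assumes "ereal r < chg N F" "p \<in> F" "q \<in> F" "p \<noteq> q"
  shows "cube N p r \<inter> cube N q r = {}"
proof -
  obtain k where k: "k < N" "p k \<noteq> q k" using F_differ assms by blast
  then have "2 * r < \<bar>p k - q k\<bar>" using gap assms by blast
  moreover have "\<bar>x k - p k\<bar> \<le> r" if "x \<in> cube N p r" for x p
  proof -
    have "x k \<in> {p k - r..p k + r}"
      using that k(1) unfolding cube_def by (intro PiE_mem[of x "{..<N}"]) auto
    then show ?thesis by auto
  qed
  ultimately show ?thesis by (smt (verit) disjoint_iff)
qed

text \<open>A face at p lies in the cube at p and so is disjoint from all other cubes. Each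
  coordinate contributes 1 plus half its side length, hence the mass tends to 1 with r.\<close>

lemma measure_face_cube:
  assumes r: "0 \<le> r" "ereal r < chg N F" and p: "p \<in> F" and q: "q \<in> F"
  shows "measure (face_measure N p s r) (cube N q r)
    = (if p = q then \<Prod>k<N. 1 + (r * Rside (s k) - r * Lside (s k)) / 2 else 0)"
proof (cases "p = q")
  case True
  have "emeasure (face_measure N p s r) (cube N p r) = ennreal (\<Prod>k<N. 1 + ((p k + r * Rside (s k)) - (p k + r * Lside (s k))) / 2)"
    unfolding cube_def using r(1)
    by (intro emeasure_rect_measure_full face_bounds) (auto simp: Lside_def Rside_def)
  then have "measure (face_measure N p s r) (cube N p r) = (\<Prod>k<N. 1 + ((p k + r * Rside (s k)) - (p k + r * Lside (s k))) / 2)"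
    using face_bounds[OF r(1)] by (intro measure_eq_emeasure_eq_ennreal prod_nonneg) (auto intro!: add_nonneg_nonneg divide_nonneg_pos)
  then show ?thesis using True by simp
next
  case False
  then have "cube N q r \<inter> face N p s r = {}"
    using cube_disjoint[OF r(2) p q] face_subset_cube[OF r(1)] by blast
  then have "measure (face_measure N p s r) (cube N q r) = 0"
    by (intro measure_rect_measure_disjoint face_bounds r cube_sets) (simp add: face_eq_rect)
  then show ?thesis using False by simp
qed

lemma omega_cubes_cube:
  assumes r: "0 \<le> r" "ereal r < chg N F" and q: "q \<in> F"
  shows "omega_cubes N F r (cube N q r)
    = (\<Sum>s\<in>Sgn N. coef (alpha N F r) (q, s) * (\<Prod>k<N. 1 + (r * Rside (s k) - r * Lside (s k)) / 2))"
proof -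
  have "omega_cubes N F r (cube N q r) = (\<Sum>p\<in>F. \<Sum>s\<in>Sgn N. coef (alpha N F r) (p, s) * measure (face_measure N p s r) (cube N q r))"
    unfolding omega_cubes_eq[OF r(1)] by (simp add: sum.cartesian_product case_prod_unfold)
  also have "\<dots> = (\<Sum>s\<in>Sgn N. coef (alpha N F r) (q, s) * measure (face_measure N q s r) (cube N q r))"
    using finite_F q by (subst sum.remove[of _ q]) (auto intro!: sum.neutral simp: measure_face_cube[OF r _ q])
  finally show ?thesis by (simp add: measure_face_cube[OF r q q])
qed

lemma omega_cubes_cubes:
  assumes r: "0 \<le> r" "ereal r < chg N F"
  shows "omega_cubes N F r (cubes N F r) = (\<Sum>q\<in>F. omega_cubes N F r (cube N q r))"
proof -
  have "measure (face_measure N p s r) (cubes N F r) = (\<Sum>q\<in>F. measure (face_measure N p s r) (cube N q r))" for p s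
    unfolding cubes_def
    using finite_F cube_disjoint[OF r(2)] cube_sets
    by (intro finite_measure.finite_measure_finite_Union[OF finite_face_measure[OF r(1)]])
      (auto simp: disjoint_family_on_def)
  then show ?thesis
    unfolding omega_cubes_eq[OF r(1)] by (simp add: sum_distrib_left) (rule sum.swap)
qed

text \<open>At r = 0 the cube at q is {q} and every face at p has the potential of the point p. The
  potential identity at q is then the weighting equation for the coefficients summed over s.\<close>

lemma weighting_eq:
  assumes q: "q \<in> F"
  shows "weighting N F q = (\<Sum>s\<in>Sgn N. coef (alpha N F 0) (q, s))"
proof (rule weighting_eqI[OF finite_F F_sub _ q])
  have 0: "0 \<in> S_set N F" using S_set_contains_interval by auto
  fix q assume q: "q \<in> F"
  have "q \<in> cube N q 0" using q F_sub by (auto simp: cube_def ell1_def PiE_iff)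
  from potential_eq_1[OF alpha_solution[OF 0] _ _ q this] chg_pos
  have "(\<Sum>ps\<in>F \<times> Sgn N. coef (alpha N F 0) ps * face_potential N 0 ps q) = 1"
    by (simp add: zero_ereal_def)
  then have "(\<Sum>p\<in>F. \<Sum>s\<in>Sgn N. coef (alpha N F 0) (p, s) * exp (- d1 N p q)) = 1"
    by (simp add: sum.cartesian_product case_prod_unfold face_potential_def face_potential_0 del: exp_inj_iff)
  then show "(\<Sum>p\<in>F. exp (- d1 N p q) * (\<Sum>s\<in>Sgn N. coef (alpha N F 0) (p, s))) = 1"
    by (simp add: sum_distrib_left mult.commute)
qed

lemma tendsto_omega_cubes_cube:
  assumes q: "q \<in> F"
  shows "((\<lambda>r. omega_cubes N F r (cube N q r)) \<longlongrightarrow> weighting N F q) (at_right 0)"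
proof -
  obtain \<rho> :: real where \<rho>: "0 < \<rho>" "ereal \<rho> \<le> chg N F" "{0..<\<rho>} \<subseteq> S_set N F"
    using S_set_contains_interval by blast
  have coef: "((\<lambda>r. coef (alpha N F r) (q, s)) \<longlongrightarrow> coef (alpha N F 0) (q, s)) (at_right 0)"
    if s: "s \<in> Sgn N" for s
  proof (cases "s = zero_dir N")
    case False
    then have "continuous_on (S_set N F) (\<lambda>r. alpha N F r (q, s))"
      using s q by (intro continuous_on_alpha) (auto simp: Dir_eq)
    then have "((\<lambda>r. alpha N F r (q, s)) \<longlongrightarrow> alpha N F 0 (q, s)) (at 0 within S_set N F)"
      using \<rho> by (auto simp: continuous_on_def)
    \<comment> \<open>Continuity on \<open>S_set\<close> only gives a limit within that set. A
      closed interval inside [0, \<rho>) replaces it, and at its left end the filter is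
      \<open>at_right 0\<close>.\<close>
    then have "((\<lambda>r. alpha N F r (q, s)) \<longlongrightarrow> alpha N F 0 (q, s)) (at 0 within {0..\<rho> / 2})"
      by (rule tendsto_within_subset) (use \<rho>(1,3) in auto)
    then show ?thesis using False \<rho>(1) by (auto simp: coef_def at_within_Icc_at_right intro!: tendsto_minus)
  qed (simp add: coef_def)
  have "((\<lambda>r. \<Sum>s\<in>Sgn N. coef (alpha N F r) (q, s) * (\<Prod>k<N. 1 + (r * Rside (s k) - r * Lside (s k)) / 2))
     \<longlongrightarrow> (\<Sum>s\<in>Sgn N. coef (alpha N F 0) (q, s) * (\<Prod>k<N. 1 + (0 * Rside (s k) - 0 * Lside (s k)) / 2))) (at_right 0)"
    by (intro tendsto_sum tendsto_mult coef tendsto_prod tendsto_intros) auto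
  moreover have "eventually (\<lambda>r. (\<Sum>s\<in>Sgn N. coef (alpha N F r) (q, s) * (\<Prod>k<N. 1 + (r * Rside (s k) - r * Lside (s k)) / 2))
     = omega_cubes N F r (cube N q r)) (at_right 0)"
    using eventually_at_right_real[OF \<rho>(1)]
  proof eventually_elim
    case (elim r)
    then have "r \<in> S_set N F" using \<rho>(3) by auto
    then show ?case using q by (subst omega_cubes_cube) (auto simp: S_set_def)
  qed
  ultimately show ?thesis
    using weighting_eq[OF q] by (simp add: tendsto_cong)
qed

text \<open>By uniqueness, \<open>omega_cubes\<close> is the weight measure in the definition of
  \<open>mag\<close>; since the cubes are disjoint, its total mass is the sum of the masses of the
  cubes.\<close>

lemma tendsto_mag_cubes: "((\<lambda>r. mag N (cubes N F r)) \<longlongrightarrow> mag_finite N F) (at_right 0)"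
proof -
  obtain \<rho> :: real where \<rho>: "0 < \<rho>" "ereal \<rho> \<le> chg N F" "{0..<\<rho>} \<subseteq> S_set N F"
    using S_set_contains_interval by blast
  have "((\<lambda>r. \<Sum>q\<in>F. omega_cubes N F r (cube N q r)) \<longlongrightarrow> mag_finite N F) (at_right 0)"
    unfolding mag_finite_def by (intro tendsto_sum tendsto_omega_cubes_cube)
  moreover have "eventually (\<lambda>r. (\<Sum>q\<in>F. omega_cubes N F r (cube N q r)) = mag N (cubes N F r)) (at_right 0)"
    using eventually_at_right_real[OF \<rho>(1)]
  proof eventually_elim
    case (elim r)
    then have r: "r \<in> S_set N F" using \<rho>(3) by auto
    have "cubes N F r \<in> sets (ell1_borel N)"
      unfolding cubes_def using finite_F cube_sets by (intro sets.finite_UN) auto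
    then have "weight_measure N (cubes N F r) = omega_cubes N F r"
      by (rule weight_measure_eq) (rule is_weight_measure_omega_cubes[OF r])
    then show ?case using r by (simp add: mag_def omega_cubes_cubes S_set_def)
  qed
  ultimately show ?thesis by (simp add: tendsto_cong)
qed

end

theorem lemma6p2:
  fixes N :: nat and F :: "point set"
  assumes "finite F" and "F \<noteq> {}" and "F \<subseteq> ell1 N"
  shows "(\<forall>r\<in>S_set N F. 0 < r \<longrightarrow> is_weight_measure N (cubes N F r) (omega_cubes N F r))
    \<and> (\<forall>p\<in>F. \<forall>s\<in>Dir N. continuous_on (S_set N F) (\<lambda>r. alpha N F r (p, s)))
    \<and> (\<exists>\<rho>::real. 0 < \<rho> \<and> ereal \<rho> \<le> chg N F \<and> {0..<\<rho>} \<subseteq> S_set N F)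
    \<and> (\<forall>p\<in>F. ((\<lambda>r. omega_cubes N F r (cube N p r)) \<longlongrightarrow> weighting N F p) (at_right 0))
    \<and> ((\<lambda>r. mag N (cubes N F r)) \<longlongrightarrow> mag_finite N F) (at_right 0)"
proof -
  interpret fragment_system N F by standard (fact assms)+
  show ?thesis
    by (intro conjI ballI impI is_weight_measure_omega_cubes continuous_on_alpha
        S_set_contains_interval tendsto_omega_cubes_cube tendsto_mag_cubes)
qed

end
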